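(* For every $d\geq 0$ the following assignment on generators defines a prop morphism $\varphi_d:\mathcal{S}\to\mathrm{End}(\mathrm{C}_\bullet(\Delta^d))$: (i) $\varepsilon\mapsto$ the augmentation map in $\mathrm{Hom}(\mathrm{C}_\bullet(\Delta^d),k)_0$, $[v_0,\dots,v_q]\mapsto 1$ if $q=0$ and $\mapsto 0$ if $q>0$; (ii) $\Delta\mapsto$ the Alexander–Whitney map in $\mathrm{Hom}(\mathrm{C}_\bullet(\Delta^d),\mathrm{C}_\bullet(\Delta^d)^{\otimes 2})_0$, $[v_0,\dots,v_q]\mapsto\sum_{i=0}^q[v_0,\dots,v_i]\otimes[v_i,\dots,v_q]$; (iii) $\mu\mapsto$ the join map in $\mathrm{Hom}(\mathrm{C}_\bullet(\Delta^d)^{\otimes 2},\mathrm{C}_\bullet(\Delta^d))_1$, $[v_0,\dots,v_p]\otimes[v_{p+1},\dots,v_q]\mapsto(-1)^p\,\mathrm{sign}(\pi)\,[v_{\pi(0)},\dots,v_{\pi(q)}]$ if the vertices $v_0,\dots,v_q$ are pairwise distinct, and $\mapsto 0$ otherwise, where $\pi$ is the permutation of $\{0,\dots,q\}$ with $v_{\pi(0)}<\dots<v_{\pi(q)}$. Moreover these morphisms are natural with respect to simplicial maps: for every order-preserving map $f:\{0,\dots,d\}\to\{0,\dots,e\}$ and every $x\in\mathcal{S}(n,m)$, $f_*^{\otimes m}\circ\varphi_d(x)=\varphi_e(x)\circ f_*^{\otimes n}$.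
   Context: Fix a commutative ring $k$; work with chain complexes of $k$-modules and the Koszul sign rule. A prop $\mathcal{P}$ is a strict symmetric monoidal category enriched in chain complexes generated by one object $p$, with $\mathcal{P}(n,m)$ the complex of morphisms $p^{\otimes n}\to p^{\otimes m}$; $\circ$ is vertical composition, $\otimes$ horizontal composition, $\mathrm{id}\in\mathcal{P}(1,1)$. For a chain complex $C$, $\mathrm{End}(C)$ is the prop with $\mathrm{End}(C)(n,m)=\mathrm{Hom}(C^{\otimes n},C^{\otimes m})$, the Hom complex graded by degree of maps with differential $(\partial f)(v)=\partial(f(v))-(-1)^{|f|}f(\partial v)$. The prop $\mathcal{S}$: the free prop on the free $\Sigma$-bimodule generated by $\varepsilon\in\mathcal{S}(1,0)$ (degree $0$), $\Delta\in\mathcal{S}(1,2)$ (degree $0$), $\mu\in\mathcal{S}(2,1)$ (degree $1$), with derivation differential given by $\partial\varepsilon=0$, $\partial\Delta=0$, $\partial\mu=(\varepsilon\otimes\mathrm{id})-(\mathrm{id}\otimes\varepsilon)$, modulo the differential graded prop ideal generated by $\varepsilon\circ\mu$, $(\varepsilon\otimes\mathrm{id})\circ\Delta-\mathrm{id}$, $(\mathrm{id}\otimes\varepsilon)\circ\Delta-\mathrm{id}$. $\mathrm{C}_\bullet(\Delta^d)$ denotes the normalized chains of the standard $d$-simplex with coefficients in $k$: it has basis the symbols $[v_0,\dots,v_q]$ with $0\leq v_0<\dots<v_q\leq d$ in degree $q$, a symbol with a repeated vertex denoting $0$, and differential $\partial[v_0,\dots,v_q]=\sum_{i}(-1)^i[v_0,\dots,\widehat{v_i},\dots,v_q]$.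 For an order-preserving $f$, $f_*[v_0,\dots,v_q]=[f(v_0),\dots,f(v_q)]$ (zero if degenerate). *)

theory Defs
  imports Main "HOL-Combinatorics.Permutations"
begin

text \<open>A basis element [v_0,...,v_q] of C(Delta^d) is a nonempty strictly increasing
  list of vertices in {0..d}; its degree is q = length - 1.  A basis element of
  C(Delta^d)^{tensor n} is a list of n such simplices.  Since C(Delta^d) is a
  finitely generated free module, an element of Hom(C^{tensor n}, C^{tensor m})
  is the same as its matrix  M xs ys  (coefficient of ys in the image of xs).\<close>

definition simplices :: "nat \<Rightarrow> nat list set" where
  "simplices d = {s. s \<noteq> [] \<and> sorted_wrt (<) s \<and> set s \<subseteq> {0..d}}"

definition basis :: "nat \<Rightarrow> nat \<Rightarrow> nat list list set" where
  "basis d n = {xs. length xs = n \<and> (\<forall>s\<in>set xs. s \<in> simplices d)}"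

definition sdeg :: "nat list \<Rightarrow> nat" where
  "sdeg s = length s - 1"

definition tdeg :: "nat list list \<Rightarrow> nat" where
  "tdeg xs = sum_list (map sdeg xs)"

type_synonym 'k mat = "nat list list \<Rightarrow> nat list list \<Rightarrow> 'k"

definition hom_el :: "nat \<Rightarrow> nat \<Rightarrow> nat \<Rightarrow> nat \<Rightarrow> 'k::comm_ring_1 mat \<Rightarrow> bool" where
  "hom_el d n m r F \<longleftrightarrow>
     (\<forall>xs ys. F xs ys \<noteq> 0 \<longrightarrow> xs \<in> basis d n \<and> ys \<in> basis d m \<and> tdeg ys = tdeg xs + r)"

definition m_id :: "nat \<Rightarrow> nat \<Rightarrow> 'k::comm_ring_1 mat" where
  "m_id d n xs ys = (if xs = ys \<and> xs \<in> basis d n then 1 else 0)"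

definition mcomp :: "nat \<Rightarrow> nat \<Rightarrow> 'k::comm_ring_1 mat \<Rightarrow> 'k mat \<Rightarrow> 'k mat" where
  "mcomp d k G F xs zs = (\<Sum>ys\<in>basis d k. F xs ys * G ys zs)"

text \<open>horizontal composition F (x) G with Koszul sign
  (f (x) g)(x (x) y) = (-1)^(|g||x|) f(x) (x) g(y); F has arity (n,m).\<close>
definition mtens :: "nat \<Rightarrow> nat \<Rightarrow> 'k::comm_ring_1 mat \<Rightarrow> 'k mat \<Rightarrow> 'k mat" where
  "mtens n m F G xs ys =
     (-1) ^ ((tdeg (drop m ys) + tdeg (drop n xs)) * tdeg (take n xs))
       * F (take n xs) (take m ys) * G (drop n xs) (drop m ys)"

definition m_tau :: "nat \<Rightarrow> 'k::comm_ring_1 mat" where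
  "m_tau d xs ys =
     (if length xs = 2 \<and> xs \<in> basis d 2 \<and> ys = [xs!1, xs!0]
      then (-1) ^ (sdeg (xs!0) * sdeg (xs!1)) else 0)"

definition remove_nth :: "nat \<Rightarrow> nat list \<Rightarrow> nat list" where
  "remove_nth j s = take j s @ drop (Suc j) s"

definition bd :: "nat list \<Rightarrow> nat list \<Rightarrow> 'k::comm_ring_1" where
  "bd s t = (\<Sum>j<length s. if 2 \<le> length s \<and> t = remove_nth j s then (-1) ^ j else 0)"

definition mdiff :: "nat \<Rightarrow> nat \<Rightarrow> 'k::comm_ring_1 mat" where
  "mdiff d n xs ys =
     (if xs \<in> basis d n \<and> ys \<in> basis d n then
        (\<Sum>i<n. if take i xs = take i ys \<and> drop (Suc i) xs = drop (Suc i) ys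
                then (-1) ^ tdeg (take i xs) * bd (xs!i) (ys!i) else 0)
      else 0)"

text \<open>differential of the Hom complex: (dF) = d o F - (-1)^|F| F o d\<close>
definition hdiff :: "nat \<Rightarrow> nat \<Rightarrow> nat \<Rightarrow> 'k::comm_ring_1 mat \<Rightarrow> 'k mat" where
  "hdiff d n m F xs zs =
     (\<Sum>ys\<in>basis d m. F xs ys * mdiff d m ys zs)
     - (\<Sum>ys\<in>basis d n. (-1) ^ (tdeg zs + tdeg ys) * mdiff d n xs ys * F ys zs)"

definition m_eps :: "nat \<Rightarrow> 'k::comm_ring_1 mat" where
  "m_eps d xs ys =
     (if length xs = 1 \<and> ys = [] \<and> xs!0 \<in> simplices d \<and> length (xs!0) = 1 then 1 else 0)"

definition m_aw :: "nat \<Rightarrow> 'k::comm_ring_1 mat" where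
  "m_aw d xs ys =
     (if length xs = 1 \<and> length ys = 2 \<and> xs!0 \<in> simplices d \<and>
         (\<exists>i<length (xs!0). ys!0 = take (Suc i) (xs!0) \<and> ys!1 = drop i (xs!0))
      then 1 else 0)"

definition sortperm :: "nat list \<Rightarrow> nat \<Rightarrow> nat" where
  "sortperm l = (THE \<pi>. \<pi> permutes {..<length l} \<and>
                        (\<forall>i j. i < j \<and> j < length l \<longrightarrow> l ! (\<pi> i) < l ! (\<pi> j)))"

definition m_join :: "nat \<Rightarrow> 'k::comm_ring_1 mat" where
  "m_join d xs ys =
     (if length xs = 2 \<and> length ys = 1 \<and> xs!0 \<in> simplices d \<and> xs!1 \<in> simplices d
         \<and> distinct (xs!0 @ xs!1)
         \<and> ys!0 = map (\<lambda>i. (xs!0 @ xs!1) ! sortperm (xs!0 @ xs!1) i) [0..<length (xs!0 @ xs!1)]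
      then (-1) ^ (length (xs!0) - 1) * of_int (sign (sortperm (xs!0 @ xs!1)))
      else 0)"

datatype gen = Eps | Dlt | Mu

text \<open>Expressions of the free prop: generators, the identity of p, the identity of
  the unit object p^0, the symmetry p(x)p -> p(x)p, vertical composition
  (Comp a b = a o b, b first) and horizontal composition.\<close>
datatype sexpr = Gen gen | Id | Id0 | Tau | Comp sexpr sexpr | Tens sexpr sexpr

fun gsrc :: "gen \<Rightarrow> nat" where
  "gsrc Eps = 1" | "gsrc Dlt = 1" | "gsrc Mu = 2"
fun gtgt :: "gen \<Rightarrow> nat" where
  "gtgt Eps = 0" | "gtgt Dlt = 2" | "gtgt Mu = 1"
fun gdeg :: "gen \<Rightarrow> nat" where
  "gdeg Eps = 0" | "gdeg Dlt = 0" | "gdeg Mu = 1"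

fun src :: "sexpr \<Rightarrow> nat" where
  "src (Gen g) = gsrc g" | "src Id = 1" | "src Id0 = 0" | "src Tau = 2"
| "src (Comp a b) = src b" | "src (Tens a b) = src a + src b"

fun tgt :: "sexpr \<Rightarrow> nat" where
  "tgt (Gen g) = gtgt g" | "tgt Id = 1" | "tgt Id0 = 0" | "tgt Tau = 2"
| "tgt (Comp a b) = tgt a" | "tgt (Tens a b) = tgt a + tgt b"

fun deg :: "sexpr \<Rightarrow> nat" where
  "deg (Gen g) = gdeg g" | "deg Id = 0" | "deg Id0 = 0" | "deg Tau = 0"
| "deg (Comp a b) = deg a + deg b" | "deg (Tens a b) = deg a + deg b"

fun wt :: "sexpr \<Rightarrow> bool" where
  "wt (Comp a b) \<longleftrightarrow> wt a \<and> wt b \<and> src a = tgt b"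
| "wt (Tens a b) \<longleftrightarrow> wt a \<and> wt b"
| "wt _ \<longleftrightarrow> True"

fun idn :: "nat \<Rightarrow> sexpr" where
  "idn 0 = Id0" | "idn (Suc n) = Tens Id (idn n)"

fun bswap1 :: "nat \<Rightarrow> sexpr" where
  "bswap1 0 = Id"
| "bswap1 (Suc n) = Comp (Tens Id (bswap1 n)) (Tens Tau (idn n))"

fun bswap :: "nat \<Rightarrow> nat \<Rightarrow> sexpr" where
  "bswap 0 n' = idn n'"
| "bswap (Suc n) n' = Comp (Tens (bswap1 n') (idn n)) (Tens Id (bswap n n'))"

type_synonym 'k comb = "('k \<times> sexpr) list"

definition smult_comb :: "'k::comm_ring_1 \<Rightarrow> 'k comb \<Rightarrow> 'k comb" where
  "smult_comb r c = map (\<lambda>(a, t). (r * a, t)) c"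

definition map_comb :: "(sexpr \<Rightarrow> sexpr) \<Rightarrow> 'k comb \<Rightarrow> 'k comb" where
  "map_comb h c = map (\<lambda>(a, t). (a, h t)) c"

primrec dS :: "sexpr \<Rightarrow> 'k::comm_ring_1 comb" where
  "dS (Gen g) = (case g of Mu \<Rightarrow> [(1, Tens (Gen Eps) Id), (-1, Tens Id (Gen Eps))] | _ \<Rightarrow> [])"
| "dS Id = []" | "dS Id0 = []" | "dS Tau = []"
| "dS (Comp a b) = map_comb (\<lambda>t. Comp t b) (dS a)
                   @ smult_comb ((-1) ^ deg a) (map_comb (\<lambda>t. Comp a t) (dS b))"
| "dS (Tens a b) = map_comb (\<lambda>t. Tens t b) (dS a)
                   @ smult_comb ((-1) ^ deg a) (map_comb (\<lambda>t. Tens a t) (dS b))"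

definition dcomb :: "'k::comm_ring_1 comb \<Rightarrow> 'k comb" where
  "dcomb c = concat (map (\<lambda>(r, t). smult_comb r (dS t)) c)"

definition eqv :: "sexpr \<Rightarrow> sexpr \<Rightarrow> 'k::comm_ring_1 comb" where
  "eqv a b = [(1, a), (-1, b)]"

definition wt_comb :: "'k comb \<Rightarrow> bool" where
  "wt_comb c \<longleftrightarrow> (\<forall>(r, t)\<in>set c. wt t)"

text \<open>Irel: the linear combinations which are zero in S, i.e. the kernel of the
  projection from formal combinations of well-typed expressions onto S: generated
  by formal cancellation, the axioms of a strict symmetric monoidal dg category
  (with Koszul signs) and the three relators, closed under linear combinations,
  composition / tensoring with arbitrary morphisms, and the differential.\<close>
inductive_set Irel :: "'k::comm_ring_1 comb set" where
  formal_zero: "wt_comb c \<Longrightarrow> (\<forall>t. sum_list (map fst (filter (\<lambda>p. snd p = t) c)) = 0)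
                  \<Longrightarrow> c \<in> Irel"
| add: "c \<in> Irel \<Longrightarrow> c' \<in> Irel \<Longrightarrow> c @ c' \<in> Irel"
| smult: "c \<in> Irel \<Longrightarrow> smult_comb r c \<in> Irel"
| comp_left: "c \<in> Irel \<Longrightarrow> wt e \<Longrightarrow> (\<forall>(r, t)\<in>set c. wt t \<and> tgt t = src e)
                \<Longrightarrow> map_comb (\<lambda>t. Comp e t) c \<in> Irel"
| comp_right: "c \<in> Irel \<Longrightarrow> wt e \<Longrightarrow> (\<forall>(r, t)\<in>set c. wt t \<and> src t = tgt e)
                \<Longrightarrow> map_comb (\<lambda>t. Comp t e) c \<in> Irel"
| tens_left: "c \<in> Irel \<Longrightarrow> wt e \<Longrightarrow> map_comb (\<lambda>t. Tens e t) c \<in> Irel"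
| tens_right: "c \<in> Irel \<Longrightarrow> wt e \<Longrightarrow> map_comb (\<lambda>t. Tens t e) c \<in> Irel"
| diff: "c \<in> Irel \<Longrightarrow> dcomb c \<in> Irel"
| comp_assoc: "wt a \<Longrightarrow> wt b \<Longrightarrow> wt c \<Longrightarrow> src a = tgt b \<Longrightarrow> src b = tgt c
                \<Longrightarrow> eqv (Comp (Comp a b) c) (Comp a (Comp b c)) \<in> Irel"
| comp_idl: "wt a \<Longrightarrow> eqv (Comp (idn (tgt a)) a) a \<in> Irel"
| comp_idr: "wt a \<Longrightarrow> eqv (Comp a (idn (src a))) a \<in> Irel"
| id_idn: "eqv (idn 1) Id \<in> Irel"
| tens_assoc: "wt a \<Longrightarrow> wt b \<Longrightarrow> wt c \<Longrightarrow> eqv (Tens (Tens a b) c) (Tens a (Tens b c)) \<in> Irel"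
| tens_unitl: "wt a \<Longrightarrow> eqv (Tens Id0 a) a \<in> Irel"
| tens_unitr: "wt a \<Longrightarrow> eqv (Tens a Id0) a \<in> Irel"
| interchange: "wt a \<Longrightarrow> wt b \<Longrightarrow> wt c \<Longrightarrow> wt e \<Longrightarrow> src a = tgt c \<Longrightarrow> src b = tgt e
                \<Longrightarrow> [(1, Comp (Tens a b) (Tens c e)),
                     (- ((-1) ^ (deg b * deg c)), Tens (Comp a c) (Comp b e))] \<in> Irel"
| tau_inv: "eqv (Comp Tau Tau) (idn 2) \<in> Irel"
| tau_natural: "wt a \<Longrightarrow> wt b
                \<Longrightarrow> [(1, Comp (bswap (tgt a) (tgt b)) (Tens a b)),
                     (- ((-1) ^ (deg a * deg b)), Comp (Tens b a) (bswap (src a) (src b)))] \<in> Irel"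
| rel_eps_mu: "[(1, Comp (Gen Eps) (Gen Mu))] \<in> Irel"
| rel_counit_l: "eqv (Comp (Tens (Gen Eps) Id) (Gen Dlt)) Id \<in> Irel"
| rel_counit_r: "eqv (Comp (Tens Id (Gen Eps)) (Gen Dlt)) Id \<in> Irel"

primrec ev :: "nat \<Rightarrow> sexpr \<Rightarrow> 'k::comm_ring_1 mat" where
  "ev d (Gen g) = (case g of Eps \<Rightarrow> m_eps d | Dlt \<Rightarrow> m_aw d | Mu \<Rightarrow> m_join d)"
| "ev d Id = m_id d 1"
| "ev d Id0 = m_id d 0"
| "ev d Tau = m_tau d"
| "ev d (Comp a b) = mcomp d (tgt b) (ev d a) (ev d b)"
| "ev d (Tens a b) = mtens (src a) (tgt a) (ev d a) (ev d b)"

definition ev_comb :: "nat \<Rightarrow> 'k::comm_ring_1 comb \<Rightarrow> 'k mat" where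
  "ev_comb d c = (\<lambda>xs ys. sum_list (map (\<lambda>(r, t). r * ev d t xs ys) c))"

text \<open>f_*^{tensor n} for order preserving f : {0..d} -> {0..e} (degree 0, no signs);
  a degenerate image simplex is zero\<close>
definition fpow :: "nat \<Rightarrow> (nat \<Rightarrow> nat) \<Rightarrow> nat \<Rightarrow> 'k::comm_ring_1 mat" where
  "fpow d f n xs ys =
     (if xs \<in> basis d n \<and> (\<forall>s\<in>set xs. distinct (map f s)) \<and> ys = map (map f) xs
      then 1 else 0)"

end

theory Submission
  imports Defs
begin

text \<open>All Koszul signs depend only on degrees modulo 2, so the differential of the tensor powers of
  \<open>C\<close> is treated as an odd matrix satisfying \<open>D(n + m) = D(n) \<otimes> 1 + 1 \<otimes> D(m)\<close>, and the differential
  of the Hom complex is the graded commutator with it. The graded interchange law then yields at once that it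
  is a derivation for both compositions, and the naturality of the signed block swaps (which
  interpret the symmetries, by the hexagon identities) yields the symmetric monoidal axioms.
  What remains concerns the generators. The Alexander-Whitney identity is a cancellation
  in a double sum. For the join, the sorting permutation has the parity of the number of
  inversions, and removing the entry at position \<open>i\<close> whose rank is \<open>r\<close> changes
  that parity by \<open>i + r\<close>. So the join behaves like the product of an exterior algebra whose differential
  sends every vertex to 1; as vertices are cycles in \<open>C\<close>, the resulting boundary formula
  misses exactly the terms \<open>\<epsilon> \<otimes> id - id \<otimes> \<epsilon>\<close>.\<close>

section \<open>Matrices between tensor powers\<close>

text \<open>Morphisms of \<open>S\<close> are represented by expressions, so a prop morphism is an
  evaluation \<open>ev\<close> that kills \<open>Irel\<close>. Since \<open>Irel\<close> is closed
  under \<open>dcomb\<close>, compatibility with the differentials is not a consequence of vanishing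
  on the relations but an ingredient of it: the boundary formulas of the generators come before the
  induction over \<open>Irel\<close>. A second obstacle is that a combination in \<open>Irel\<close>
  may have terms of different arities, while \<open>mcomp\<close>, \<open>mtens\<close> and
  \<open>hdiff\<close> take arities as arguments; the induction carries \<open>wt_comb\<close> along
  so that these can be recovered from the lengths of the indices. Matrices may run between two
  dimensions \<open>d\<close> and \<open>e\<close>, so that the induced map \<open>fpow\<close>
  obeys the same interchange and swap laws as the operations; having degree 0 it causes no signs,
  and naturality reduces to the generators and the symmetry. In \<open>F xs ys\<close> the rows are
  sources, and \<open>mcomp d k G F\<close> applies \<open>F\<close> before
  \<open>G\<close>.\<close>

lemma finite_simplices: "finite (simplices d)"
proof (rule finite_subset)
  show "simplices d \<subseteq> {s. set s \<subseteq> {0..d} \<and> length s \<le> Suc d}"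
  proof
    fix s assume s: "s \<in> simplices d"
    then have "distinct s" by (auto simp: simplices_def strict_sorted_iff)
    moreover have "card (set s) \<le> card {0..d}"
      using s by (intro card_mono) (auto simp: simplices_def)
    ultimately have "length s \<le> Suc d" by (simp add: distinct_card)
    then show "s \<in> {s. set s \<subseteq> {0..d} \<and> length s \<le> Suc d}"
      using s by (auto simp: simplices_def)
  qed
  show "finite {s. set s \<subseteq> {0..d} \<and> length s \<le> Suc d}"
    by (rule finite_lists_length_le) simp
qed

lemma finite_basis: "finite (basis d n)"
proof -
  have "basis d n = {xs. set xs \<subseteq> simplices d \<and> length xs = n}"
    by (auto simp: basis_def)
  then show ?thesis using finite_lists_length_eq[OF finite_simplices] by simp
qed

section \<open>Bases of tensor powers and their degrees\<close>

lemma basis_length: "xs \<in> basis d n \<Longrightarrow> length xs = n"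
  by (simp add: basis_def)

lemma basis_append:
  "length xs = n \<Longrightarrow> xs @ ys \<in> basis d (n + m) \<longleftrightarrow> xs \<in> basis d n \<and> ys \<in> basis d m"
  by (auto simp: basis_def)

lemma take_in_basis: "xs \<in> basis d (n + m) \<Longrightarrow> take n xs \<in> basis d n"
  by (auto simp: basis_def dest: in_set_takeD)

lemma drop_in_basis: "xs \<in> basis d (n + m) \<Longrightarrow> drop n xs \<in> basis d m"
  by (auto simp: basis_def dest: in_set_dropD)

lemma basis_split:
  assumes "xs \<in> basis d (n + m)"
  obtains x y where "xs = x @ y" "x \<in> basis d n" "y \<in> basis d m"
  using assms take_in_basis drop_in_basis by (metis append_take_drop_id)

lemma basis_take_drop:
  assumes "take n xs \<in> basis d n" "drop n xs \<in> basis d m"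
  shows "xs \<in> basis d (n + m)"
  using assms basis_append[OF basis_length[OF assms(1)], of "drop n xs" d m] by simp

lemma basis_0: "basis d 0 = {[]}"
  by (auto simp: basis_def)

lemma basis_1: "basis d 1 = (\<lambda>s. [s]) ` simplices d"
  by (auto simp: basis_def length_Suc_conv)

text \<open>A basis element of the power \<open>n + m\<close> is cut uniquely after \<open>n\<close>
  factors, so sums over the intermediate index of a tensor product become double sums.\<close>

lemma sum_basis_append:
  "(\<Sum>ys\<in>basis d (n + m). h ys) = (\<Sum>y\<in>basis d n. \<Sum>z\<in>basis d m. h (y @ z))"
  unfolding sum.cartesian_product
  by (rule sum.reindex_bij_witness[where i = "\<lambda>(a, b). a @ b" and j = "\<lambda>ys. (take n ys, drop n ys)"])
     (auto simp: basis_append basis_length take_in_basis drop_in_basis)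

lemma sum_basis_1: "(\<Sum>ys\<in>basis d 1. h ys) = (\<Sum>s\<in>simplices d. h [s])"
  unfolding basis_1 by (subst sum.reindex) (auto simp: inj_on_def)

lemma tdeg_append [simp]: "tdeg (xs @ ys) = tdeg xs + tdeg ys"
  by (simp add: tdeg_def)

lemma tdeg_Nil [simp]: "tdeg [] = 0"
  by (simp add: tdeg_def)

lemma tdeg_Cons [simp]: "tdeg (x # xs) = sdeg x + tdeg xs"
  by (simp add: tdeg_def)

lemma tdeg_split: "tdeg xs = tdeg (take n xs) + tdeg (drop n xs)"
  by (metis append_take_drop_id tdeg_append)

text \<open>Longer comparisons of Koszul signs go through this rule: exponents are collected by
  \<open>power_add\<close>, and only the parity of their sum is checked.\<close>

lemma sign_eq: "even (a + b) \<Longrightarrow> (- 1 :: 'k::comm_ring_1) ^ a = (- 1) ^ b"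
  by (auto simp: minus_one_power_iff)

text \<open>Only the parity \<open>p\<close> of the degree is recorded, so that \<open>mdiff\<close>, which lowers the degree, is covered too.\<close>

definition homp :: "nat \<Rightarrow> nat \<Rightarrow> nat \<Rightarrow> nat \<Rightarrow> nat \<Rightarrow> 'k::comm_ring_1 mat \<Rightarrow> bool" where
  "homp d e n m p F \<longleftrightarrow>
     (\<forall>xs ys. F xs ys \<noteq> 0 \<longrightarrow> xs \<in> basis d n \<and> ys \<in> basis e m \<and> even (tdeg xs + tdeg ys + p))"

lemma hompD:
  assumes "homp d e n m p F" "F xs ys \<noteq> 0"
  shows "xs \<in> basis d n" "ys \<in> basis e m" "even (tdeg xs + tdeg ys + p)"
  using assms by (auto simp: homp_def)

lemma homp_zero:
  assumes "homp d e n m p F" "xs \<notin> basis d n \<or> ys \<notin> basis e m"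
  shows "F xs ys = 0"
  using assms by (auto simp: homp_def)

text \<open>Matrices are total functions on lists; \<open>homp\<close> forces the value 0 off the
  bases, which reduces equality to basis elements. The parities \<open>p\<close> and
  \<open>q\<close> may differ, as when one side is the zero matrix.\<close>

lemma mat_eqI:
  assumes "homp d e n m p F" "homp d e n m q G"
    and "\<And>xs ys. xs \<in> basis d n \<Longrightarrow> ys \<in> basis e m \<Longrightarrow> F xs ys = G xs ys"
  shows "F = G"
proof (intro ext)
  fix xs ys
  show "F xs ys = G xs ys"
    using assms homp_zero[OF assms(1)] homp_zero[OF assms(2)]
    by (cases "xs \<in> basis d n \<and> ys \<in> basis e m") auto
qed

lemma hom_el_homp: "hom_el d n m r F \<Longrightarrow> homp d d n m r F"
  by (auto simp: homp_def hom_el_def)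

lemma homp_mcomp:
  assumes "homp d e n k p F" "homp e g k m q G"
  shows "homp d g n m (p + q) (mcomp e k G F)"
  unfolding homp_def
proof (intro allI impI)
  fix xs zs assume "mcomp e k G F xs zs \<noteq> 0"
  then obtain ys where "F xs ys * G ys zs \<noteq> 0"
    unfolding mcomp_def by (blast elim: sum.not_neutral_contains_not_neutral)
  then have "F xs ys \<noteq> 0" "G ys zs \<noteq> 0" by auto
  from hompD[OF assms(1) this(1)] hompD[OF assms(2) this(2)]
  show "xs \<in> basis d n \<and> zs \<in> basis g m \<and> even (tdeg xs + tdeg zs + (p + q))"
    by auto
qed

lemma homp_mtens:
  assumes "homp d e n m p F" "homp d e n' m' q G"
  shows "homp d e (n + n') (m + m') (p + q) (mtens n m F G)"
  unfolding homp_def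
proof (intro allI impI)
  fix xs ys assume "mtens n m F G xs ys \<noteq> 0"
  then have "F (take n xs) (take m ys) \<noteq> 0" "G (drop n xs) (drop m ys) \<noteq> 0"
    by (auto simp: mtens_def)
  from hompD[OF assms(1) this(1)] hompD[OF assms(2) this(2)]
  show "xs \<in> basis d (n + n') \<and> ys \<in> basis e (m + m') \<and> even (tdeg xs + tdeg ys + (p + q))"
    unfolding tdeg_split[of xs n] tdeg_split[of ys m] by (auto intro: basis_take_drop)
qed

lemma hom_el_mcomp:
  assumes "hom_el d n k p F" "hom_el d k m q G"
  shows "hom_el d n m (q + p) (mcomp d k G F)"
  unfolding hom_el_def
proof (intro allI impI)
  fix xs zs assume "mcomp d k G F xs zs \<noteq> 0"
  then obtain ys where "F xs ys * G ys zs \<noteq> 0"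
    unfolding mcomp_def by (blast elim: sum.not_neutral_contains_not_neutral)
  then have "F xs ys \<noteq> 0" "G ys zs \<noteq> 0" by auto
  with assms show "xs \<in> basis d n \<and> zs \<in> basis d m \<and> tdeg zs = tdeg xs + (q + p)"
    by (auto simp: hom_el_def)
qed

lemma hom_el_mtens:
  assumes "hom_el d n m p F" "hom_el d n' m' q G"
  shows "hom_el d (n + n') (m + m') (p + q) (mtens n m F G)"
  unfolding hom_el_def
proof (intro allI impI)
  fix xs ys assume "mtens n m F G xs ys \<noteq> 0"
  then have "F (take n xs) (take m ys) \<noteq> 0" "G (drop n xs) (drop m ys) \<noteq> 0"
    by (auto simp: mtens_def)
  with assms tdeg_split[of xs n] tdeg_split[of ys m]
  show "xs \<in> basis d (n + n') \<and> ys \<in> basis d (m + m') \<and> tdeg ys = tdeg xs + (p + q)"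
    by (auto simp: hom_el_def intro: basis_take_drop)
qed

lemma hom_el_m_id: "hom_el d n n 0 (m_id d n)"
  by (auto simp: hom_el_def m_id_def)

section \<open>Category and monoidal axioms for matrices\<close>

lemma mcomp_assoc: "mcomp d k (mcomp e l H G) F = mcomp e l H (mcomp d k G F)"
proof (intro ext)
  fix xs zs
  have "mcomp d k (mcomp e l H G) F xs zs
      = (\<Sum>ys\<in>basis d k. \<Sum>ws\<in>basis e l. F xs ys * G ys ws * H ws zs)"
    by (simp add: mcomp_def sum_distrib_left mult.assoc)
  also have "\<dots> = (\<Sum>ws\<in>basis e l. \<Sum>ys\<in>basis d k. F xs ys * G ys ws * H ws zs)"
    by (rule sum.swap)
  also have "\<dots> = mcomp e l H (mcomp d k G F) xs zs"
    by (simp add: mcomp_def sum_distrib_right)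
  finally show "mcomp d k (mcomp e l H G) F xs zs = mcomp e l H (mcomp d k G F) xs zs" .
qed

text \<open>Swaps, the join and \<open>fpow\<close> send a basis element to a multiple of a basis
  element, so a product with one of them applied first collapses to a single term.\<close>

lemma mcomp_single:
  assumes "\<And>ys. ys \<in> basis d k \<Longrightarrow> ys \<noteq> w \<Longrightarrow> F xs ys = 0" "w \<in> basis d k"
  shows "mcomp d k G F xs zs = F xs w * G w zs"
  unfolding mcomp_def using assms
  by (subst sum.remove[of _ w]) (auto simp: finite_basis intro!: sum.neutral)

lemma mcomp_single':
  assumes "\<And>ys. ys \<in> basis d k \<Longrightarrow> ys \<noteq> w \<Longrightarrow> G ys zs = 0" "w \<in> basis d k"
  shows "mcomp d k G F xs zs = F xs w * G w zs"
  unfolding mcomp_def using assms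
  by (subst sum.remove[of _ w]) (auto simp: finite_basis intro!: sum.neutral)

lemma mcomp_id_left:
  assumes "homp d e n m p F"
  shows "mcomp e m (m_id e m) F = F"
proof (rule mat_eqI)
  show "homp d e n m (p + 0) (mcomp e m (m_id e m) F)"
    by (rule homp_mcomp[OF assms hom_el_homp[OF hom_el_m_id]])
  show "mcomp e m (m_id e m) F xs ys = F xs ys" if "ys \<in> basis e m" for xs ys
    by (subst mcomp_single'[of _ _ ys]) (use that in \<open>auto simp: m_id_def\<close>)
qed (fact assms)

lemma mcomp_id_right:
  assumes "homp d e n m p F"
  shows "mcomp d n F (m_id d n) = F"
proof (rule mat_eqI)
  show "homp d e n m (0 + p) (mcomp d n F (m_id d n))"
    by (rule homp_mcomp[OF hom_el_homp[OF hom_el_m_id] assms])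
  show "mcomp d n F (m_id d n) xs ys = F xs ys" if "xs \<in> basis d n" for xs ys
    by (subst mcomp_single[of _ _ xs]) (use that in \<open>auto simp: m_id_def\<close>)
qed (fact assms)

lemma mtens_append:
  assumes "length x = n" "length y = m"
  shows "mtens n m F G (x @ x') (y @ y')
    = (-1) ^ ((tdeg y' + tdeg x') * tdeg x) * F x y * G x' y'"
  using assms by (simp add: mtens_def)

text \<open>Both bracketings give the same exponent: the sum over pairs of factors i < j of the
  degree of the j-th map, read off its entry, times the degree of the i-th argument.\<close>

lemma mtens_assoc:
  "mtens (n + n') (m + m') (mtens n m F G) H = mtens n m F (mtens n' m' G H)"
proof (intro ext)
  fix xs ys
  let ?x1 = "tdeg (take n xs)" and ?x2 = "tdeg (take n' (drop n xs))"
    and ?x3 = "tdeg (drop (n' + n) xs)" and ?y2 = "tdeg (take m' (drop m ys))"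
    and ?y3 = "tdeg (drop (m' + m) ys)"
  have t: "tdeg (take (n + n') xs) = ?x1 + ?x2"
    "tdeg (drop n xs) = ?x2 + ?x3" "tdeg (drop m ys) = ?y2 + ?y3"
    using tdeg_split[of "take (n + n') xs" n] tdeg_split[of "drop n xs" n']
      tdeg_split[of "drop m ys" m']
    by (auto simp: drop_take ac_simps)
  have s: "(- 1 :: 'a) ^ ((?y3 + ?x3) * (?x1 + ?x2)) * (- 1) ^ ((?y2 + ?x2) * ?x1)
     = (- 1) ^ ((?y2 + ?y3 + (?x2 + ?x3)) * ?x1) * (- 1) ^ ((?y3 + ?x3) * ?x2)"
    unfolding power_add[symmetric] by (rule sign_eq) (simp; blast)
  show "mtens (n + n') (m + m') (mtens n m F G) H xs ys = mtens n m F (mtens n' m' G H) xs ys"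
    using s t unfolding mtens_def
    by (simp add: drop_take ac_simps)
qed

lemma mtens_id:
  "mtens n n (m_id d n) (m_id d m) = (m_id d (n + m) :: 'k::comm_ring_1 mat)"
proof (rule mat_eqI)
  show "homp d d (n + m) (n + m) (0 + 0) (mtens n n (m_id d n) (m_id d m) :: 'k mat)"
    by (intro homp_mtens hom_el_homp hom_el_m_id)
  show "homp d d (n + m) (n + m) 0 (m_id d (n + m) :: 'k mat)"
    by (intro hom_el_homp hom_el_m_id)
  fix xs ys assume xs: "xs \<in> basis d (n + m)" and ys: "ys \<in> basis d (n + m)"
  obtain x x' where x: "xs = x @ x'" "x \<in> basis d n" "x' \<in> basis d m" using basis_split[OF xs] .
  obtain y y' where y: "ys = y @ y'" "y \<in> basis d n" "y' \<in> basis d m" using basis_split[OF ys] .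
  show "mtens n n (m_id d n) (m_id d m) xs ys = m_id d (n + m) xs ys"
    using x y by (auto simp: mtens_append basis_length m_id_def basis_append minus_one_power_iff)
qed

lemma mtens_id0_left:
  assumes "homp d e n m p F"
  shows "mtens 0 0 (m_id d 0) F = F"
  by (intro ext) (simp add: mtens_def m_id_def basis_0)

lemma mtens_id0_right:
  assumes "homp d e n m p F"
  shows "mtens n m F (m_id c 0) = F"
proof (intro ext)
  fix xs ys
  show "mtens n m F (m_id c 0) xs ys = F xs ys"
  proof (cases "F xs ys = 0")
    case False
    then show ?thesis using hompD[OF assms, of xs ys]
      by (auto simp: mtens_def m_id_def basis_0 basis_length)
  next
    case True
    then show ?thesis by (auto simp: mtens_def m_id_def basis_0)
  qed
qed

text \<open>The global sign is the price of moving \<open>B\<close> past \<open>C\<close>; all other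
  signs are absorbed into those of the tensor product of the two composites.\<close>

lemma interchange_law:
  assumes A: "homp e g k m a A" and B: "homp e g k' m' b B"
    and C: "homp d e n k c C" and E: "homp d e n' k' c' E"
  shows "mcomp e (k + k') (mtens k m A B) (mtens n k C E)
    = (\<lambda>xs ys. (-1) ^ (b * c) * mtens n m (mcomp e k A C) (mcomp e k' B E) xs ys)"
proof (intro ext)
  fix xs zs :: "nat list list"
  let ?x1 = "take n xs" and ?x2 = "drop n xs" and ?z1 = "take m zs" and ?z2 = "drop m zs"
  let ?s = "(- 1 :: 'a) ^ (b * c) * (- 1) ^ ((tdeg ?z2 + tdeg ?x2) * tdeg ?x1)"
  \<comment> \<open>On nonzero terms \<open>tdeg y1\<close> has the parity of
    \<open>tdeg ?x1 + c\<close>, and \<open>tdeg ?z2 + tdeg y2\<close> that of \<open>b\<close>.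
    Substituting both removes the intermediate degrees from the exponent, so the sign leaves the
    double sum.\<close>
  have *: "(- 1) ^ ((tdeg y2 + tdeg ?x2) * tdeg ?x1) * C ?x1 y1 * E ?x2 y2
        * ((- 1) ^ ((tdeg ?z2 + tdeg y2) * tdeg y1) * A y1 ?z1 * B y2 ?z2)
      = ?s * ((C ?x1 y1 * A y1 ?z1) * (E ?x2 y2 * B y2 ?z2))" for y1 y2
  proof (cases "C ?x1 y1 = 0 \<or> B y2 ?z2 = 0")
    case False
    then have "even (tdeg ?x1 + tdeg y1 + c)" "even (tdeg y2 + tdeg ?z2 + b)"
      using hompD[OF B] hompD[OF C] by auto
    then have "(- 1 :: 'a) ^ ((tdeg y2 + tdeg ?x2) * tdeg ?x1) * (- 1) ^ ((tdeg ?z2 + tdeg y2) * tdeg y1) = ?s"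
      unfolding power_add[symmetric] by (intro sign_eq) (simp; blast)
    moreover have "p * c * e * (q * a * b) = (p * q) * ((c * a) * (e * b))" for p q c e a b :: 'a
      by (simp add: ac_simps)
    ultimately show ?thesis by (simp only:)
  qed auto
  have "mcomp e (k + k') (mtens k m A B) (mtens n k C E) xs zs
     = (\<Sum>y1\<in>basis e k. \<Sum>y2\<in>basis e k'. ?s * ((C ?x1 y1 * A y1 ?z1) * (E ?x2 y2 * B y2 ?z2)))"
    unfolding mcomp_def sum_basis_append
    by (intro sum.cong refl) (simp add: mtens_def basis_length * )
  also have "\<dots> = ?s * ((\<Sum>y1\<in>basis e k. C ?x1 y1 * A y1 ?z1) * (\<Sum>y2\<in>basis e k'. E ?x2 y2 * B y2 ?z2))"
    unfolding sum_product by (simp only: sum_distrib_left)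
  finally show "mcomp e (k + k') (mtens k m A B) (mtens n k C E) xs zs
      = (-1) ^ (b * c) * mtens n m (mcomp e k A C) (mcomp e k' B E) xs zs"
    by (simp add: mtens_def mcomp_def mult.assoc)
qed

section \<open>Block swaps\<close>

text \<open>A closed form of the symmetry between blocks of \<open>n\<close> and \<open>m\<close>
  factors, against which the recursive expressions \<open>bswap\<close> are compared.\<close>

definition swapm :: "nat \<Rightarrow> nat \<Rightarrow> nat \<Rightarrow> 'k::comm_ring_1 mat" where
  "swapm d n m xs ys =
     (if xs \<in> basis d (n + m) \<and> ys = drop n xs @ take n xs
      then (-1) ^ (tdeg (take n xs) * tdeg (drop n xs)) else 0)"

lemma hom_el_swapm: "hom_el d (n + m) (m + n) 0 (swapm d n m :: 'k::comm_ring_1 mat)"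
  unfolding hom_el_def
proof (intro allI impI)
  fix xs ys assume "(swapm d n m :: 'k mat) xs ys \<noteq> 0"
  then have xs: "xs \<in> basis d (n + m)" and ys: "ys = drop n xs @ take n xs"
    by (auto simp: swapm_def split: if_splits)
  then show "xs \<in> basis d (n + m) \<and> ys \<in> basis d (m + n) \<and> tdeg ys = tdeg xs + 0"
    using take_in_basis[OF xs] drop_in_basis[OF xs] tdeg_split[of xs n]
    by (simp add: basis_append basis_length)
qed

lemma swapm_append:
  assumes "x \<in> basis d n" "y \<in> basis d m"
  shows "swapm d n m (x @ y) zs = (if zs = y @ x then (-1) ^ (tdeg x * tdeg y) else 0)"
  using assms by (auto simp: swapm_def basis_append basis_length)

lemma swapm_0_left: "swapm d 0 n = m_id d n"
  by (intro ext) (auto simp: swapm_def m_id_def)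

lemma swapm_0_right: "swapm d n 0 = m_id d n"
  by (intro ext) (auto simp: swapm_def m_id_def basis_length)

text \<open>Carrying a block past \<open>a + b\<close> factors means carrying it past
  \<open>a\<close>, then past \<open>b\<close>. The exponent of the swap is bilinear in the degrees,
  so the two signs multiply to the required one; the identity factors contribute even
  exponents.\<close>

lemma swapm_hexagon1:
  "mcomp d (a + n + b) (mtens a a (m_id d a) (swapm d n b)) (mtens (n + a) (a + n) (swapm d n a) (m_id d b))
    = (swapm d n (a + b) :: 'k::comm_ring_1 mat)"
proof (rule mat_eqI)
  let ?F = "mtens (n + a) (a + n) (swapm d n a) (m_id d b) :: 'k mat"
  let ?G = "mtens a a (m_id d a) (swapm d n b) :: 'k mat"
  have "homp d d (n + a + b) (a + n + b) (0 + 0) ?F"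
    by (intro homp_mtens hom_el_homp hom_el_swapm hom_el_m_id)
  moreover have "homp d d (a + (n + b)) (a + (b + n)) (0 + 0) ?G"
    by (intro homp_mtens hom_el_homp hom_el_swapm hom_el_m_id)
  ultimately show "homp d d (n + (a + b)) (a + b + n) 0 (mcomp d (a + n + b) ?G ?F)"
    using homp_mcomp[of d d "n + a + b" "a + n + b" 0 ?F d "a + b + n" 0 ?G] by (simp add: ac_simps)
  show "homp d d (n + (a + b)) (a + b + n) 0 (swapm d n (a + b) :: 'k mat)"
    by (intro hom_el_homp hom_el_swapm)
  fix xs zs assume "xs \<in> basis d (n + (a + b))" "zs \<in> basis d (a + b + n)"
  then obtain x y z where xs: "xs = x @ y @ z" and b: "x \<in> basis d n" "y \<in> basis d a" "z \<in> basis d b"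
    by (metis basis_split)
  have l: "length x = n" "length y = a" "length z = b" using b by (auto simp: basis_length)
  have F: "?F xs ys = (if ys = y @ x @ z then (-1) ^ (tdeg x * tdeg y) else 0)" if ys: "ys \<in> basis d (a + n + b)" for ys
  proof -
    obtain u v where uv: "ys = u @ v" "u \<in> basis d (a + n)" "v \<in> basis d b" using basis_split[OF ys] .
    have "?F ((x @ y) @ z) (u @ v) = (-1) ^ ((tdeg v + tdeg z) * tdeg (x @ y)) * swapm d n a (x @ y) u * m_id d b z v"
      by (rule mtens_append) (use uv l in \<open>auto simp: basis_length\<close>)
    moreover have "u @ v = y @ x @ z \<longleftrightarrow> u = y @ x \<and> v = z"
      using append_eq_append_conv[of u "y @ x" v z] uv l by (simp add: basis_length)
    ultimately show ?thesis using uv b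
      by (auto simp: xs swapm_append m_id_def minus_one_power_iff)
  qed
  have yxz: "y @ x @ z \<in> basis d (a + n + b)"
    using b l by (simp add: basis_append add.assoc)
  have "mcomp d (a + n + b) ?G ?F xs zs = ?F xs (y @ x @ z) * ?G (y @ x @ z) zs"
    by (rule mcomp_single) (auto simp: F yxz)
  also have "\<dots> = (-1) ^ (tdeg x * tdeg y) * ?G (y @ x @ z) zs" using F[OF yxz] by simp
  also have "?G (y @ x @ z) zs = (if zs = y @ z @ x then (-1) ^ (tdeg x * tdeg z) else 0)"
  proof -
    obtain u v where uv: "zs = u @ v" "u \<in> basis d a" "v \<in> basis d (b + n)"
      using \<open>zs \<in> basis d (a + b + n)\<close> by (metis add.assoc basis_split)
    show ?thesis using uv l b
      by (auto simp: mtens_append basis_length swapm_append m_id_def minus_one_power_iff)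
  qed
  also have "(-1) ^ (tdeg x * tdeg y) * \<dots> = (swapm d n (a + b) xs zs :: 'k)"
    unfolding xs using b by (subst swapm_append) (auto simp: basis_append l power_add distrib_left)
  finally show "mcomp d (a + n + b) ?G ?F xs zs = swapm d n (a + b) xs zs" .
qed

text \<open>The mirror image: here the last block travels to the left, past \<open>b\<close> factors
  and then past \<open>a\<close>.\<close>

lemma swapm_hexagon2:
  "mcomp d (a + n + b) (mtens (a + n) (n + a) (swapm d a n) (m_id d b)) (mtens a a (m_id d a) (swapm d b n))
    = (swapm d (a + b) n :: 'k::comm_ring_1 mat)"
proof (rule mat_eqI)
  let ?G = "mtens (a + n) (n + a) (swapm d a n) (m_id d b) :: 'k mat"
  let ?F = "mtens a a (m_id d a) (swapm d b n) :: 'k mat"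
  have "homp d d (a + n + b) (n + a + b) (0 + 0) ?G"
    by (intro homp_mtens hom_el_homp hom_el_swapm hom_el_m_id)
  moreover have "homp d d (a + (b + n)) (a + (n + b)) (0 + 0) ?F"
    by (intro homp_mtens hom_el_homp hom_el_swapm hom_el_m_id)
  ultimately show "homp d d (a + b + n) (n + (a + b)) 0 (mcomp d (a + n + b) ?G ?F)"
    using homp_mcomp[of d d "a + b + n" "a + n + b" 0 ?F d "n + a + b" 0 ?G] by (simp add: ac_simps)
  show "homp d d (a + b + n) (n + (a + b)) 0 (swapm d (a + b) n :: 'k mat)"
    by (intro hom_el_homp hom_el_swapm)
  fix xs zs assume "xs \<in> basis d (a + b + n)" "zs \<in> basis d (n + (a + b))"
  then obtain x y z where xs: "xs = x @ y @ z" and b: "x \<in> basis d a" "y \<in> basis d b" "z \<in> basis d n"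
    by (metis basis_split add.assoc)
  have l: "length x = a" "length y = b" "length z = n" using b by (auto simp: basis_length)
  have F: "?F xs ys = (if ys = x @ z @ y then (-1) ^ (tdeg y * tdeg z) else 0)" if ys: "ys \<in> basis d (a + n + b)" for ys
  proof -
    obtain u v where uv: "ys = u @ v" "u \<in> basis d a" "v \<in> basis d (n + b)"
      using ys by (metis add.assoc basis_split)
    show ?thesis using uv l b
      by (auto simp: xs mtens_append basis_length swapm_append m_id_def minus_one_power_iff)
  qed
  have xzy: "x @ z @ y \<in> basis d (a + n + b)"
    using b l by (simp add: basis_append add.assoc)
  have "mcomp d (a + n + b) ?G ?F xs zs = ?F xs (x @ z @ y) * ?G (x @ z @ y) zs"
    by (rule mcomp_single) (auto simp: F xzy)
  also have "\<dots> = (-1) ^ (tdeg y * tdeg z) * ?G (x @ z @ y) zs" using F[OF xzy] by simp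
  also have "?G (x @ z @ y) zs = (if zs = z @ x @ y then (-1) ^ (tdeg x * tdeg z) else 0)"
  proof -
    obtain u v where uv: "zs = u @ v" "u \<in> basis d (n + a)" "v \<in> basis d b"
      using \<open>zs \<in> basis d (n + (a + b))\<close> by (metis add.assoc basis_split)
    have "?G ((x @ z) @ y) (u @ v) = (-1) ^ ((tdeg v + tdeg y) * tdeg (x @ z)) * swapm d a n (x @ z) u * m_id d b y v"
      by (rule mtens_append) (use uv l in \<open>auto simp: basis_length\<close>)
    moreover have "u @ v = z @ x @ y \<longleftrightarrow> u = z @ x \<and> v = y"
      using append_eq_append_conv[of u "z @ x" v y] uv l by (simp add: basis_length)
    ultimately show ?thesis using uv b
      by (auto simp: xs swapm_append m_id_def minus_one_power_iff)
  qed
  also have "(-1) ^ (tdeg y * tdeg z) * \<dots> = (swapm d (a + b) n xs zs :: 'k)"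
    unfolding xs append_assoc[symmetric] using b
    by (subst swapm_append) (auto simp: basis_append l power_add distrib_right distrib_left mult.commute)
  finally show "mcomp d (a + n + b) ?G ?F xs zs = swapm d (a + b) n xs zs" .
qed

text \<open>This serves three purposes: the naturality axiom of the symmetry in \<open>Irel\<close>,
  the fact that swaps are chain maps (one matrix is \<open>mdiff\<close>, the other an identity),
  and the compatibility of \<open>m_tau\<close> with \<open>fpow\<close>.\<close>

lemma swapm_natural:
  fixes A B :: "'k::comm_ring_1 mat"
  assumes A: "homp d e n m a A" and B: "homp d e n' m' b B"
  shows "mcomp e (m + m') (swapm e m m') (mtens n m A B)
    = (\<lambda>xs ys. (-1) ^ (a * b) * mcomp d (n' + n) (mtens n' m' B A) (swapm d n n') xs ys)"
proof (rule mat_eqI)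
  show "homp d e (n + n') (m' + m) (a + b + 0) (mcomp e (m + m') (swapm e m m') (mtens n m A B))"
    by (intro homp_mcomp homp_mtens A B hom_el_homp hom_el_swapm)
  have "homp d e (n + n') (m' + m) (0 + (b + a)) (mcomp d (n' + n) (mtens n' m' B A) (swapm d n n'))"
    by (intro homp_mcomp homp_mtens A B hom_el_homp hom_el_swapm)
  then show "homp d e (n + n') (m' + m) (0 + (b + a))
    (\<lambda>xs ys. (-1) ^ (a * b) * mcomp d (n' + n) (mtens n' m' B A) (swapm d n n') xs ys)"
    by (auto simp: homp_def minus_one_power_iff)
  fix xs zs assume "xs \<in> basis d (n + n')" "zs \<in> basis e (m' + m)"
  then obtain x y u v where xs: "xs = x @ y" "x \<in> basis d n" "y \<in> basis d n'"
    and zs: "zs = u @ v" "u \<in> basis e m'" "v \<in> basis e m"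
    by (metis basis_split)
  have "mcomp e (m + m') (swapm e m m') (mtens n m A B) xs zs
      = mtens n m A B xs (v @ u) * swapm e m m' (v @ u) zs"
    by (rule mcomp_single')
      (use zs in \<open>auto simp: basis_append basis_length swapm_append elim!: basis_split split: if_splits\<close>)
  also have "\<dots> = (-1) ^ ((tdeg u + tdeg y) * tdeg x) * (-1) ^ (tdeg v * tdeg u) * (A x v * B y u)"
    using xs zs by (simp add: mtens_append basis_length swapm_append)
  also have "\<dots> = (-1) ^ (a * b) * ((-1) ^ (tdeg x * tdeg y) * (-1) ^ ((tdeg v + tdeg x) * tdeg y)) * (A x v * B y u)"
  proof (cases "A x v = 0 \<or> B y u = 0")
    case False
    then have "even (tdeg x + tdeg v + a)" "even (tdeg y + tdeg u + b)"
      using hompD[OF A] hompD[OF B] by auto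
    then have "(- 1 :: 'k) ^ ((tdeg u + tdeg y) * tdeg x) * (-1) ^ (tdeg v * tdeg u)
       = (-1) ^ (a * b) * ((-1) ^ (tdeg x * tdeg y) * (-1) ^ ((tdeg v + tdeg x) * tdeg y))"
      unfolding power_add[symmetric] by (intro sign_eq) (simp; blast)
    then show ?thesis by simp
  qed auto
  also have "\<dots> = (-1) ^ (a * b) * (swapm d n n' xs (y @ x) * mtens n' m' B A (y @ x) zs)"
    using xs zs by (simp add: mtens_append basis_length swapm_append)
  also have "swapm d n n' xs (y @ x) * mtens n' m' B A (y @ x) zs
      = mcomp d (n' + n) (mtens n' m' B A) (swapm d n n') xs zs"
    by (rule mcomp_single[symmetric])
       (use xs in \<open>auto simp: basis_append basis_length swapm_append\<close>)
  finally show "mcomp e (m + m') (swapm e m m') (mtens n m A B) xs zs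
     = (-1) ^ (a * b) * mcomp d (n' + n) (mtens n' m' B A) (swapm d n n') xs zs" .
qed

section \<open>The differential\<close>

lemma mcomp_add_left:
  "mcomp d k (\<lambda>xs ys. F xs ys + G xs ys) H = (\<lambda>xs ys. mcomp d k F H xs ys + mcomp d k G H xs ys)"
  by (simp add: fun_eq_iff mcomp_def distrib_left sum.distrib)

lemma mcomp_add_right:
  "mcomp d k F (\<lambda>xs ys. G xs ys + H xs ys) = (\<lambda>xs ys. mcomp d k F G xs ys + mcomp d k F H xs ys)"
  by (simp add: fun_eq_iff mcomp_def distrib_right sum.distrib)

lemma mcomp_diff_left:
  "mcomp d k (\<lambda>xs ys. F xs ys - G xs ys) H = (\<lambda>xs ys. mcomp d k F H xs ys - mcomp d k G H xs ys)"
  by (simp add: fun_eq_iff mcomp_def right_diff_distrib sum_subtractf)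

lemma mcomp_diff_right:
  "mcomp d k F (\<lambda>xs ys. G xs ys - H xs ys) = (\<lambda>xs ys. mcomp d k F G xs ys - mcomp d k F H xs ys)"
  by (simp add: fun_eq_iff mcomp_def left_diff_distrib sum_subtractf)

lemma mcomp_scale_left:
  "mcomp d k (\<lambda>xs ys. r * F xs ys) H = (\<lambda>xs ys. r * mcomp d k F H xs ys)"
  by (simp add: fun_eq_iff mcomp_def sum_distrib_left ac_simps)

lemma mcomp_scale_right:
  "mcomp d k F (\<lambda>xs ys. r * H xs ys) = (\<lambda>xs ys. r * mcomp d k F H xs ys)"
  by (simp add: fun_eq_iff mcomp_def sum_distrib_left ac_simps)

lemma mtens_diff_left:
  "mtens n m (\<lambda>xs ys. F xs ys - G xs ys) H = (\<lambda>xs ys. mtens n m F H xs ys - mtens n m G H xs ys)"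
  by (simp add: fun_eq_iff mtens_def algebra_simps)

lemma mtens_diff_right:
  "mtens n m F (\<lambda>xs ys. G xs ys - H xs ys) = (\<lambda>xs ys. mtens n m F G xs ys - mtens n m F H xs ys)"
  by (simp add: fun_eq_iff mtens_def algebra_simps)

lemma mtens_scale_left:
  "mtens n m (\<lambda>xs ys. r * F xs ys) H = (\<lambda>xs ys. r * mtens n m F H xs ys)"
  by (simp add: fun_eq_iff mtens_def ac_simps)

lemma mtens_scale_right:
  "mtens n m F (\<lambda>xs ys. r * H xs ys) = (\<lambda>xs ys. r * mtens n m F H xs ys)"
  by (simp add: fun_eq_iff mtens_def ac_simps)

section \<open>The boundary as an odd matrix, and the Hom differential\<close>

lemma length_remove_nth: "j < length s \<Longrightarrow> length (remove_nth j s) = length s - 1"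
  by (simp add: remove_nth_def)

lemma bd_nonzero_length:
  assumes "bd s t \<noteq> 0" shows "length s = Suc (length t)" "2 \<le> length s"
proof -
  obtain j where "j < length s" "(if 2 \<le> length s \<and> t = remove_nth j s then (-1) ^ j else 0) \<noteq> (0 :: 'a)"
    using assms unfolding bd_def by (force elim: sum.not_neutral_contains_not_neutral)
  then show "length s = Suc (length t)" "2 \<le> length s"
    by (auto simp: length_remove_nth split: if_splits)
qed

lemma bd_nonzero_sdeg:
  assumes "bd s t \<noteq> 0" shows "sdeg s = Suc (sdeg t)"
  using bd_nonzero_length[OF assms] by (auto simp: sdeg_def)

text \<open>A nonzero entry changes a single tensor factor, which loses one vertex.\<close>

lemma homp_mdiff: "homp d d n n 1 (mdiff d n)"
  unfolding homp_def
proof (intro allI impI)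
  fix xs ys assume nz: "mdiff d n xs ys \<noteq> (0 :: 'a)"
  then have b: "xs \<in> basis d n" "ys \<in> basis d n" by (auto simp: mdiff_def split: if_splits)
  with nz obtain i where i: "i < n" "take i xs = take i ys" "drop (Suc i) xs = drop (Suc i) ys"
    "bd (xs ! i) (ys ! i) \<noteq> (0 :: 'a)"
    unfolding mdiff_def by (auto elim!: sum.not_neutral_contains_not_neutral dest!: mult_not_zero split: if_splits)
  have "tdeg zs = tdeg (take i zs) + sdeg (zs ! i) + tdeg (drop (Suc i) zs)" if "zs \<in> basis d n" for zs
    using i(1) that id_take_nth_drop[of i zs] by (metis add.assoc basis_length tdeg_Cons tdeg_append)
  with i b bd_nonzero_sdeg[OF i(4)] show "xs \<in> basis d n \<and> ys \<in> basis d n \<and> even (tdeg xs + tdeg ys + 1)"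
    by simp
qed

text \<open>\<open>hdiff\<close> reads its sign off the degrees of an entry of \<open>F\<close>
  instead of taking the degree as an argument; on nonzero entries of a homogeneous matrix that sign
  is constant.\<close>

lemma hdiff_eq:
  assumes "homp d d n m p F"
  shows "hdiff d n m F
    = (\<lambda>xs zs. mcomp d m (mdiff d m) F xs zs - (-1) ^ p * mcomp d n F (mdiff d n) xs zs)"
proof (intro ext)
  fix xs zs
  have "(-1) ^ (tdeg zs + tdeg ys) * mdiff d n xs ys * F ys zs = (-1) ^ p * (mdiff d n xs ys * F ys zs)" for ys
  proof (cases "F ys zs = 0")
    case False
    then have "(-1 :: 'a) ^ (tdeg zs + tdeg ys) = (-1) ^ p"
      using hompD(3)[OF assms False] by (intro sign_eq) (simp add: ac_simps)
    then show ?thesis by (simp add: mult.assoc)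
  qed simp
  then show "hdiff d n m F xs zs
    = mcomp d m (mdiff d m) F xs zs - (-1) ^ p * mcomp d n F (mdiff d n) xs zs"
    by (simp add: fun_eq_iff hdiff_def mcomp_def sum_distrib_left)
qed

lemma homp_add:
  assumes "homp d e n m p F" "homp d e n m p G"
  shows "homp d e n m p (\<lambda>xs ys. F xs ys + G xs ys)"
  using assms unfolding homp_def by (metis add.left_neutral)

lemma homp_diff:
  assumes "homp d e n m p F" "homp d e n m p G"
  shows "homp d e n m p (\<lambda>xs ys. F xs ys - G xs ys)"
  using assms unfolding homp_def by (metis diff_zero)

lemma homp_scale:
  assumes "homp d e n m p F"
  shows "homp d e n m p (\<lambda>xs ys. r * F xs ys)"
  using assms unfolding homp_def by (metis mult_zero_right)

lemma homp_hdiff: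
  assumes "homp d d n m p F"
  shows "homp d d n m (Suc p) (hdiff d n m F)"
  unfolding hdiff_eq[OF assms]
  using homp_mcomp[OF assms homp_mdiff] homp_mcomp[OF homp_mdiff assms]
  by (intro homp_diff homp_scale) auto

section \<open>The derivation property for composition and tensor product\<close>

lemma sum_lessThan_add: "(\<Sum>i<a + b::nat. f i) = (\<Sum>i<a. f i) + (\<Sum>i<b. f (a + i))"
  by (induction b) (auto simp: add.assoc)

text \<open>Positions below \<open>n\<close> give the first summand, the others the second. The
  demand in \<open>mdiff\<close> that all other factors agree turns into an identity matrix on the
  other block.\<close>

lemma mdiff_add:
  "mdiff d (n + m) = (\<lambda>xs ys. mtens n n (mdiff d n) (m_id d m) xs ys
     + (mtens n n (m_id d n) (mdiff d m) :: 'k::comm_ring_1 mat) xs ys)"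
proof (rule mat_eqI)
  show "homp d d (n + m) (n + m) 1 (mdiff d (n + m))" by (rule homp_mdiff)
  have "homp d d (n + m) (n + m) (1 + 0) (mtens n n (mdiff d n) (m_id d m :: 'k mat))"
    by (intro homp_mtens homp_mdiff hom_el_homp[OF hom_el_m_id])
  moreover have "homp d d (n + m) (n + m) (0 + 1) (mtens n n (m_id d n :: 'k mat) (mdiff d m))"
    by (intro homp_mtens homp_mdiff hom_el_homp[OF hom_el_m_id])
  ultimately show "homp d d (n + m) (n + m) 1 (\<lambda>xs ys. mtens n n (mdiff d n) (m_id d m) xs ys
     + (mtens n n (m_id d n) (mdiff d m) :: 'k mat) xs ys)"
    by (intro homp_add) auto
  fix xs ys assume xs: "xs \<in> basis d (n + m)" and ys: "ys \<in> basis d (n + m)"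
  obtain x x' where x: "xs = x @ x'" "x \<in> basis d n" "x' \<in> basis d m" using basis_split[OF xs] .
  obtain y y' where y: "ys = y @ y'" "y \<in> basis d n" "y' \<in> basis d m" using basis_split[OF ys] .
  have l: "length x = n" "length y = n" "length x' = m" "length y' = m"
    using x y by (auto simp: basis_length)
  define g where "g i = (if take i xs = take i ys \<and> drop (Suc i) xs = drop (Suc i) ys
                then (-1) ^ tdeg (take i xs) * bd (xs!i) (ys!i) else (0::'k))" for i
  have "mdiff d (n + m) xs ys = (\<Sum>i<n. g i) + (\<Sum>i<m. g (n + i))"
    using xs ys by (simp add: mdiff_def g_def sum_lessThan_add)
  also have "(\<Sum>i<n. g i) = mtens n n (mdiff d n) (m_id d m) xs ys"
  proof (cases "x' = y'")
    case True
    then have "(\<Sum>i<n. g i) = mdiff d n x y"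
      unfolding mdiff_def using x y l
      by (auto simp: g_def nth_append intro!: sum.cong)
    then show ?thesis using True x y l by (simp add: mtens_append m_id_def minus_one_power_iff)
  next
    case False
    then have "(\<Sum>i<n. g i) = 0"
      using x y l by (intro sum.neutral) (auto simp: g_def)
    then show ?thesis using False x y l by (simp add: mtens_append m_id_def)
  qed
  also have "(\<Sum>i<m. g (n + i)) = mtens n n (m_id d n) (mdiff d m) xs ys"
  proof (cases "x = y")
    case True
    have "(\<Sum>i<m. g (n + i)) = (-1) ^ tdeg x * mdiff d m x' y'"
      unfolding mdiff_def sum_distrib_left using True x y l
      by (auto simp: g_def nth_append power_add sum_distrib_left intro!: sum.cong)
    \<comment> \<open>The sign \<open>(-1) ^ tdeg x\<close> built into \<open>mdiff\<close> is the
      Koszul sign of an odd map past \<open>x\<close>: on nonzero entries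
      \<open>tdeg y' + tdeg x'\<close> is odd.\<close>
    also have "\<dots> = (-1) ^ ((tdeg y' + tdeg x') * tdeg x) * mdiff d m x' y'"
    proof (cases "mdiff d m x' y' = (0 :: 'k)")
      case False
      then have "odd (tdeg y' + tdeg x')" using hompD(3)[OF homp_mdiff False] by auto
      then have "(-1 :: 'k) ^ tdeg x = (-1) ^ ((tdeg y' + tdeg x') * tdeg x)"
        by (intro sign_eq) auto
      then show ?thesis by simp
    qed simp
    finally show ?thesis using True x y l by (simp add: mtens_append m_id_def)
  next
    case False
    then have "(\<Sum>i<m. g (n + i)) = 0"
      using x y l by (intro sum.neutral) (auto simp: g_def)
    then show ?thesis using False x y l by (simp add: mtens_append m_id_def)
  qed
  finally show "mdiff d (n + m) xs ys = mtens n n (mdiff d n) (m_id d m) xs ys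
     + (mtens n n (m_id d n) (mdiff d m) xs ys :: 'k)" .
qed

lemma minus_one_power_mult_self: "(- 1 :: 'k::comm_ring_1) ^ a * ((- 1) ^ a * x) = x"
  by (simp add: minus_one_power_iff)

text \<open>The two terms with the differential between \<open>G\<close> and \<open>F\<close>
  cancel.\<close>

lemma hdiff_mcomp:
  assumes F: "homp d d n k p F" and G: "homp d d k m q G"
  shows "hdiff d n m (mcomp d k G F)
    = (\<lambda>xs ys. mcomp d k (hdiff d k m G) F xs ys + (-1) ^ q * mcomp d k G (hdiff d n k F) xs ys)"
  unfolding hdiff_eq[OF homp_mcomp[OF F G]] hdiff_eq[OF F] hdiff_eq[OF G]
    mcomp_diff_left mcomp_diff_right mcomp_scale_left mcomp_scale_right mcomp_assoc
  by (simp add: algebra_simps power_add)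

text \<open>Of the four interchanges two carry a sign: the differential acting after
  \<open>G\<close> passes \<open>F\<close> and costs \<open>(-1) ^ p\<close>; the one acting before
  \<open>F\<close> is passed by \<open>G\<close> and costs \<open>(-1) ^ q\<close>.\<close>

lemma hdiff_mtens:
  fixes F G :: "'k::comm_ring_1 mat"
  assumes F: "homp d d n m p F" and G: "homp d d n' m' q G"
  shows "hdiff d (n + n') (m + m') (mtens n m F G)
    = (\<lambda>xs ys. mtens n m (hdiff d n m F) G xs ys + (-1) ^ p * mtens n m F (hdiff d n' m' G) xs ys)"
proof -
  note I = hom_el_homp[OF hom_el_m_id]
  show ?thesis
    unfolding hdiff_eq[OF homp_mtens[OF F G]] hdiff_eq[OF F] hdiff_eq[OF G]
      mdiff_add mcomp_add_left mcomp_add_right mtens_diff_left mtens_diff_right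
      mtens_scale_left mtens_scale_right
      interchange_law[OF homp_mdiff I F G] interchange_law[OF I homp_mdiff F G]
      interchange_law[OF F G homp_mdiff I] interchange_law[OF F G I homp_mdiff]
      mcomp_id_left[OF F] mcomp_id_left[OF G] mcomp_id_right[OF F] mcomp_id_right[OF G]
    by (simp add: algebra_simps power_add minus_one_power_mult_self)
qed

lemma hdiff_m_id: "hdiff d n n (m_id d n) = (\<lambda>xs ys. 0)"
  unfolding hdiff_eq[OF hom_el_homp[OF hom_el_m_id]]
  by (simp add: mcomp_id_left[OF homp_mdiff] mcomp_id_right[OF homp_mdiff])

text \<open>Naturality trades a differential on one block for one on the other; with an identity as
  the other matrix the exponent of the sign is 0.\<close>

lemma hdiff_swapm: "hdiff d (n + m) (m + n) (swapm d n m) = (\<lambda>xs ys. 0)"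
proof -
  note I = hom_el_homp[OF hom_el_m_id]
  show ?thesis
    unfolding hdiff_eq[OF hom_el_homp[OF hom_el_swapm]] mdiff_add
      mcomp_add_left mcomp_add_right swapm_natural[OF homp_mdiff I] swapm_natural[OF I homp_mdiff]
    by (simp add: add.commute)
qed

lemma m_tau_swapm: "m_tau d = swapm d 1 1"
proof (intro ext)
  fix xs ys
  show "m_tau d xs ys = swapm d 1 1 xs ys"
  proof (cases "xs \<in> basis d 2")
    case True
    then obtain a b where "xs = [a, b]"
      by (auto simp: basis_def length_Suc_conv numeral_2_eq_2)
    then show ?thesis using True by (simp add: m_tau_def swapm_def numeral_2_eq_2)
  qed (simp add: m_tau_def swapm_def numeral_2_eq_2)
qed

lemma hdiff_scale: "hdiff d n m (\<lambda>xs ys. r * F xs ys) = (\<lambda>xs ys. r * hdiff d n m F xs ys)"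
  by (simp add: fun_eq_iff hdiff_def sum_distrib_left right_diff_distrib ac_simps)

lemma hdiff_add:
  "hdiff d n m (\<lambda>xs ys. F xs ys + G xs ys) = (\<lambda>xs ys. hdiff d n m F xs ys + hdiff d n m G xs ys)"
  by (simp add: fun_eq_iff hdiff_def sum.distrib algebra_simps)

lemma hdiff_zero: "hdiff d n m (\<lambda>xs ys. 0) = (\<lambda>xs ys. 0)"
  by (simp add: fun_eq_iff hdiff_def)

section \<open>Signs of sorting permutations\<close>

fun inversions :: "nat list \<Rightarrow> nat" where
  "inversions [] = 0"
| "inversions (x # l) = length (filter (\<lambda>y. y < x) l) + inversions l"

text \<open>Isolates the share of a single entry, from which the effect of removing or moving an
  entry is computed.\<close>

lemma inversions_insert:
  "inversions (u @ a # v)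
    = inversions (u @ v) + length (filter (\<lambda>y. a < y) u) + length (filter (\<lambda>y. y < a) v)"
  by (induction u) auto

lemma inversions_sorted: "sorted l \<Longrightarrow> inversions l = 0"
  by (induction l) (auto simp: filter_empty_conv)

lemma unsorted_descent: "\<not> sorted l \<Longrightarrow> \<exists>u a b v. l = u @ a # b # v \<and> (b::nat) < a"
proof (induction l)
  case (Cons x l)
  show ?case
  proof (cases "sorted l")
    case True
    with Cons.prems obtain b v where "l = b # v" "b < x"
      by (cases l) auto
    then show ?thesis by (metis append_Nil)
  next
    case False
    with Cons.IH show ?thesis by (metis append_Cons)
  qed
qed simp

text \<open>Makes the definite description usable: a sorting permutation exists because
  \<open>sort l\<close> has the multiset of \<open>l\<close>, and it is unique because indexing into
  a distinct list is injective.\<close>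

lemma sortperm_iff:
  assumes "distinct l"
  shows "sortperm l = p \<longleftrightarrow> p permutes {..<length l} \<and> permute_list p l = sort l"
proof -
  let ?C = "\<lambda>p. p permutes {..<length l} \<and> (\<forall>i j. i < j \<and> j < length l \<longrightarrow> l ! p i < l ! p j)"
  have C: "?C p \<longleftrightarrow> p permutes {..<length l} \<and> permute_list p l = sort l" for p
  proof (cases "p permutes {..<length l}")
    case True
    have "(\<forall>i j. i < j \<and> j < length l \<longrightarrow> l ! p i < l ! p j) \<longleftrightarrow> sorted_wrt (<) (permute_list p l)"
      by (auto simp: sorted_wrt_iff_nth_less permute_list_def)
    also have "\<dots> \<longleftrightarrow> permute_list p l = sort l"
    proof
      assume "sorted_wrt (<) (permute_list p l)"
      then show "permute_list p l = sort l"
        using True by (intro properties_for_sort[symmetric]) (auto simp: strict_sorted_iff)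
    qed (use assms in \<open>auto simp: strict_sorted_iff\<close>)
    finally show ?thesis using True by simp
  qed simp
  obtain q where q: "q permutes {..<length l}" "permute_list q l = sort l"
    by (rule mset_eq_permutation[of "sort l" l]) auto
  have uniq: "p = q" if p: "p permutes {..<length l}" "permute_list p l = sort l" for p
  proof
    fix i
    show "p i = q i"
    proof (cases "i < length l")
      case True
      then have "l ! p i = l ! q i"
        using p q permute_list_nth[of p l i] permute_list_nth[of q l i] by simp
      moreover have "p i < length l" "q i < length l"
        using True p q by (auto dest: permutes_in_image)
      ultimately show ?thesis using assms by (simp add: nth_eq_iff_index_eq)
    next
      case False
      then show ?thesis using p q by (simp add: permutes_not_in)
    qed
  qed
  have "sortperm l = q"
    unfolding sortperm_def
  proof (rule the_equality)
    show "?C q" using C[of q] q by blast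
    show "p = q" if "?C p" for p using C[of p] that uniq by blast
  qed
  then show ?thesis using q uniq by blast
qed

lemma map_sortperm:
  assumes "distinct l"
  shows "map (\<lambda>i. l ! sortperm l i) [0..<length l] = sort l"
  using sortperm_iff[OF assms, of "sortperm l"] by (simp add: permute_list_def)

text \<open>The lists differ by an adjacent transposition, so composing the sorting permutation of
  one with it sorts the other.\<close>

lemma sign_sortperm_swap:
  assumes "distinct (u @ a # b # v)"
  shows "sign (sortperm (u @ b # a # v)) = - sign (sortperm (u @ a # b # v))"
proof -
  let ?l = "u @ a # b # v" and ?l' = "u @ b # a # v"
  let ?t = "transpose (length u) (Suc (length u))"
  define p where "p = sortperm ?l"
  have p: "p permutes {..<length ?l}" "permute_list p ?l = sort ?l"
    using sortperm_iff[OF assms, of p] by (auto simp: p_def)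
  have t: "?t permutes {..<length ?l'}"
    by (rule permutes_swap_id) auto
  have tl: "permute_list ?t ?l' = ?l"
  proof (rule nth_equalityI)
    fix i assume "i < length (permute_list ?t ?l')"
    then have "i < length ?l'" by simp
    then have "permute_list ?t ?l' ! i = ?l' ! ?t i"
      using t by (intro permute_list_nth)
    also have "\<dots> = ?l ! i"
      by (auto simp: transpose_def nth_append nth_Cons split: nat.splits)
    finally show "permute_list ?t ?l' ! i = ?l ! i" .
  qed simp
  have "permute_list (?t \<circ> p) ?l' = sort ?l"
    using p tl by (subst permute_list_compose) auto
  also have "sort ?l = sort ?l'"
    by (rule properties_for_sort) auto
  finally have "sortperm ?l' = ?t \<circ> p"
    using assms p t by (subst sortperm_iff) (auto intro: permutes_compose)
  moreover have "sign (?t \<circ> p) = sign ?t * sign p"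
    using p t by (intro sign_compose) (auto intro: permutation_permutes[THEN iffD2])
  ultimately show ?thesis by (simp add: sign_swap_id p_def)
qed

text \<open>Bubble sort: swapping an adjacent descent removes exactly one inversion and flips the
  sign.\<close>

lemma sign_sortperm:
  assumes "distinct l"
  shows "sign (sortperm l) = (-1) ^ inversions l"
  using assms
proof (induction "inversions l" arbitrary: l rule: less_induct)
  case less
  show ?case
  proof (cases "sorted l")
    case True
    then have "sortperm l = id"
      using less.prems by (subst sortperm_iff) (auto simp: permutes_id sorted_sort_id)
    then show ?thesis using True by (simp add: inversions_sorted)
  next
    case False
    then obtain u a b v where l: "l = u @ a # b # v" and ab: "b < a"
      using unsorted_descent by blast
    let ?l' = "u @ b # a # v"
    have i: "inversions l = Suc (inversions ?l')"
      using ab by (simp add: l inversions_insert)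
    have "sign (sortperm l) = - sign (sortperm ?l')"
      using less.prems sign_sortperm_swap[of u b a v] by (auto simp: l)
    also have "sign (sortperm ?l') = (-1) ^ inversions ?l'"
      using less.prems i by (intro less.hyps) (auto simp: l)
    also have "- ((-1) ^ inversions ?l') = ((-1) ^ inversions l :: int)"
      by (simp add: i)
    finally show ?thesis .
  qed
qed

text \<open>The coefficient of the increasing monomial \<open>z\<close> in the exterior product of
  the entries of \<open>l\<close>. It is defined for any list, including \<open>x @ y\<close> with
  one of the parts empty; the prefactor \<open>(-1) ^ sdeg x\<close> of the join is kept
  outside.\<close>

definition join_coeff :: "nat list \<Rightarrow> nat list \<Rightarrow> 'k::comm_ring_1" where
  "join_coeff l z = (if distinct l \<and> z = sort l then (-1) ^ inversions l else 0)"

lemma m_join_eq: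
  assumes "x \<in> simplices d" "y \<in> simplices d"
  shows "m_join d [x, y] [z] = (-1) ^ sdeg x * join_coeff (x @ y) z"
  using assms
  by (auto simp: m_join_def join_coeff_def sdeg_def map_sortperm sign_sortperm simp del: length_append)

section \<open>Removing one entry before sorting\<close>

lemma remove_nth_append1: "i < length x \<Longrightarrow> remove_nth i (x @ y) = remove_nth i x @ y"
  by (simp add: remove_nth_def)

lemma remove_nth_append2: "remove_nth (length x + i) (x @ y) = x @ remove_nth i y"
  by (simp add: remove_nth_def)

lemma sorted_partition:
  "sorted l \<Longrightarrow> filter (\<lambda>y. y < a) l @ filter (\<lambda>y. \<not> y < (a :: nat)) l = l"
proof (induction l)
  case (Cons x l)
  then have "filter (\<lambda>y. y < a) l = []" if "\<not> x < a"
    using that by (auto simp: filter_empty_conv)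
  with Cons show ?case by auto
qed simp

text \<open>No other entry equals \<open>a = l ! i\<close>, so the sorted remainder splits into
  entries below and above \<open>a\<close>. Putting \<open>a\<close> between them gives
  \<open>sort l\<close>, with \<open>a\<close> at the index counting the smaller entries.\<close>

lemma sort_remove_nth:
  assumes "distinct l" "i < length l"
  shows "sort (remove_nth i l) = remove_nth (length (filter (\<lambda>y. y < l ! i) l)) (sort l)"
proof -
  define a u v where "a = l ! i" and "u = take i l" and "v = drop (Suc i) l"
  have l: "l = u @ a # v" "remove_nth i l = u @ v"
    using assms by (auto simp: a_def u_def v_def id_take_nth_drop remove_nth_def)
  have d: "distinct (u @ a # v)" using assms l by simp
  let ?s = "sort (u @ v)"
  let ?lo = "filter (\<lambda>y. y < a) ?s" and ?hi = "filter (\<lambda>y. a < y) ?s"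
  have hi: "?hi = filter (\<lambda>y. \<not> y < a) ?s"
    using d by (intro filter_cong) auto
  have s: "?s = ?lo @ ?hi"
    unfolding hi by (rule sorted_partition[symmetric]) simp
  have sl: "sort l = ?lo @ a # ?hi"
  proof (rule properties_for_sort)
    have "mset (?lo @ ?hi) = mset (u @ v)" using s by (metis mset_sort)
    then show "mset (?lo @ a # ?hi) = mset l" by (simp add: l)
    have "sorted ?lo" "sorted ?hi" by (auto intro: sorted_filter[of id, simplified])
    then show "sorted (?lo @ a # ?hi)" by (auto simp: sorted_append)
  qed
  have "length (filter (\<lambda>y. y < l ! i) l) = length (filter (\<lambda>y. y < a) (sort l))"
    unfolding a_def by (metis mset_filter mset_sort size_mset)
  also have "\<dots> = length ?lo" by (simp add: sl)
  finally have k: "length (filter (\<lambda>y. y < l ! i) l) = length ?lo" .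
  have r: "remove_nth (length ?lo) (sort l) = ?lo @ ?hi"
    by (simp add: sl remove_nth_def)
  show ?thesis unfolding k l(2) r by (rule s)
qed

text \<open>Removing \<open>a\<close> loses one inversion for each larger entry before it and each
  smaller entry after it. The position counts smaller and larger entries before \<open>a\<close>,
  the rank counts smaller entries before and after; in their sum the smaller ones before occur
  twice.\<close>

lemma remove_nth_inversions_parity:
  assumes "distinct l" "i < length l"
  shows "even (i + inversions (remove_nth i l) + (length (filter (\<lambda>y. y < l ! i) l) + inversions l))"
proof -
  define a u v where "a = l ! i" and "u = take i l" and "v = drop (Suc i) l"
  have l: "l = u @ a # v" "remove_nth i l = u @ v" "i = length u"
    using assms by (auto simp: a_def u_def v_def id_take_nth_drop remove_nth_def)
  have "length u = length (filter (\<lambda>y. y < a) u) + length (filter (\<lambda>y. \<not> y < a) u)"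
    by (simp add: sum_length_filter_compl)
  also have "filter (\<lambda>y. \<not> y < a) u = filter (\<lambda>y. a < y) u"
    using assms(1) unfolding l by (intro filter_cong) auto
  finally have e: "length u = length (filter (\<lambda>y. y < a) u) + length (filter (\<lambda>y. a < y) u)" .
  have "even (length u + inversions (u @ v) + (length (filter (\<lambda>y. y < a) (u @ a # v)) + inversions (u @ a # v)))"
    unfolding e by (simp add: inversions_insert; blast)
  then show ?thesis
    unfolding a_def[symmetric] l(2) l(1)[symmetric] l(3)[symmetric] .
qed

section \<open>The generators\<close>

lemma rank_sorted:
  assumes "sorted_wrt (<) (s :: nat list)" "j < length s"
  shows "length (filter (\<lambda>y. y < s ! j) s) = j"
proof -
  have "s ! i < s ! j \<longleftrightarrow> i < j" if "i < length s" for i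
    using sorted_wrt_nth_less[OF assms(1), of i j] sorted_wrt_nth_less[OF assms(1), of j i] assms(2) that
    by (cases i j rule: linorder_cases) auto
  then have "{i. i < length s \<and> s ! i < s ! j} = {..<j}"
    using assms(2) by auto
  then show ?thesis by (simp add: length_filter_conv_card)
qed

text \<open>A rank depends only on the multiset of entries, so the sum may run over
  \<open>sort l\<close>, whose \<open>j\<close>-th entry has rank \<open>j\<close>.\<close>

lemma sum_over_ranks:
  fixes l :: "nat list" and g :: "nat \<Rightarrow> 'k::comm_monoid_add"
  assumes "distinct l"
  shows "(\<Sum>i<length l. g (length (filter (\<lambda>y. y < l ! i) l))) = (\<Sum>j<length l. g j)"
proof -
  let ?r = "\<lambda>a. length (filter (\<lambda>y. y < a) l)"
  have r: "?r a = length (filter (\<lambda>y. y < a) (sort l))" for a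
    by (metis mset_filter mset_sort size_mset)
  have "(\<Sum>i<length l. g (?r (l ! i))) = sum_list (map (\<lambda>a. g (?r a)) l)"
    by (simp add: sum_list_sum_nth atLeast0LessThan)
  also have "\<dots> = sum_list (map (\<lambda>a. g (?r a)) (sort l))"
    by (simp only: sum_mset_sum_list[symmetric] mset_map mset_sort)
  also have "\<dots> = (\<Sum>j<length l. g (?r (sort l ! j)))"
    by (simp add: sum_list_sum_nth atLeast0LessThan)
  also have "\<dots> = (\<Sum>j<length l. g j)"
    using assms by (intro sum.cong refl) (simp add: r rank_sorted strict_sorted_iff)
  finally show ?thesis .
qed

text \<open>Term \<open>i\<close> on the left is, up to the common sign, the term of the boundary of
  \<open>sort l\<close> indexed by the rank of \<open>l ! i\<close>; ranks permute the
  indices.\<close>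

lemma boundary_join_distinct:
  assumes "distinct l"
  shows "(\<Sum>i<length l. (-1) ^ i * join_coeff (remove_nth i l) z)
    = (-1) ^ inversions l * (\<Sum>j<length l. if z = remove_nth j (sort l) then (-1) ^ j else 0 :: 'k::comm_ring_1)"
proof -
  let ?r = "\<lambda>i. length (filter (\<lambda>y. y < l ! i) l)"
  let ?g = "\<lambda>j. if z = remove_nth j (sort l) then (-1) ^ j else 0 :: 'k"
  have "(-1) ^ i * join_coeff (remove_nth i l) z = (-1) ^ inversions l * ?g (?r i)" if i: "i < length l" for i
  proof -
    have "distinct (take i l @ l ! i # drop (Suc i) l)"
      using assms id_take_nth_drop[OF i] by simp
    then have "distinct (remove_nth i l)"
      by (simp add: remove_nth_def)
    moreover have "(-1) ^ i * (-1) ^ inversions (remove_nth i l) = (-1) ^ inversions l * ((-1) ^ ?r i :: 'k)"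
      unfolding power_add[symmetric]
      using remove_nth_inversions_parity[OF assms i] by (intro sign_eq) (simp add: ac_simps)
    ultimately show ?thesis
      using sort_remove_nth[OF assms i] by (auto simp: join_coeff_def)
  qed
  then show ?thesis
    by (simp add: sum_distrib_left[symmetric] sum_over_ranks[OF assms, of ?g])
qed

text \<open>Deleting anything but one of two chosen copies of \<open>a\<close> leaves a repetition.
  The positions in the two surviving terms differ by \<open>length v + 1\<close>, while moving
  \<open>a\<close> across \<open>v\<close> changes the inversions by the parity of
  \<open>length v\<close>; hence they cancel.\<close>

lemma boundary_join_not_distinct:
  assumes "\<not> distinct l"
  shows "(\<Sum>i<length l. (-1) ^ i * join_coeff (remove_nth i l) z) = (0 :: 'k::comm_ring_1)"
proof -
  obtain u a v w where l: "l = u @ a # v @ a # w"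
    using not_distinct_decomp[OF assms] by auto
  let ?f = "\<lambda>i. (-1) ^ i * join_coeff (remove_nth i l) z :: 'k"
  have len: "length l = length u + (1 + (length v + (1 + length w)))"
    by (simp add: l)
  have f1: "?f i = 0" if "i < length u" for i
    using that by (simp add: l remove_nth_append1 join_coeff_def)
  have f2: "?f (length u + (1 + i)) = 0" if "i < length v" for i
    using that remove_nth_append1[of i v "a # w"]
    by (simp add: l remove_nth_append2 join_coeff_def) (simp add: remove_nth_def)
  have f3: "?f (length u + (1 + (length v + (1 + i)))) = 0" if "i < length w" for i
  proof -
    have "remove_nth (length u + (1 + (length v + (1 + i)))) l = u @ a # v @ a # remove_nth i w"
      using remove_nth_append2[of "u @ a # v @ [a]" i w] by (simp add: l ac_simps)
    then show ?thesis by (simp add: join_coeff_def)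
  qed
  have "(\<Sum>i<length l. ?f i) = ?f (length u) + ?f (length u + (1 + length v))"
    unfolding len sum_lessThan_add using f1 f2 f3 by simp
  also have "\<dots> = (-1) ^ length u * join_coeff (u @ v @ a # w) z
      + (-1) ^ (length u + (1 + length v)) * join_coeff (u @ a # v @ w) z"
    by (simp add: l remove_nth_def)
  \<comment> \<open>The two remaining lists have the same entries, so a further repetition kills
    both coefficients at once.\<close>
  also have "\<dots> = 0"
  proof (cases "distinct (u @ v @ a # w)")
    case True
    have "length v = length (filter (\<lambda>y. y < a) v) + length (filter (\<lambda>y. \<not> y < a) v)"
      by (simp add: sum_length_filter_compl)
    also have "filter (\<lambda>y. \<not> y < a) v = filter (\<lambda>y. a < y) v"
      using True by (intro filter_cong) auto
    finally have e: "length v = length (filter (\<lambda>y. y < a) v) + length (filter (\<lambda>y. a < y) v)" .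
    have "inversions (u @ v @ a # w) = inversions (u @ v @ w) + length (filter (\<lambda>y. a < y) (u @ v))
        + length (filter (\<lambda>y. y < a) w)"
      using inversions_insert[of "u @ v" a w] by simp
    moreover have "inversions (u @ a # v @ w) = inversions (u @ v @ w) + length (filter (\<lambda>y. a < y) u)
        + length (filter (\<lambda>y. y < a) (v @ w))"
      by (rule inversions_insert)
    ultimately have "even (inversions (u @ v @ a # w) + (length v + inversions (u @ a # v @ w)))"
      unfolding e by (simp; blast)
    then have s: "(-1) ^ inversions (u @ v @ a # w) = (-1) ^ length v * ((-1) ^ inversions (u @ a # v @ w) :: 'k)"
      unfolding power_add[symmetric] by (rule sign_eq)
    have "sort (u @ v @ a # w) = sort (u @ a # v @ w)"
      by (rule properties_for_sort) auto
    then show ?thesis using True s by (auto simp: join_coeff_def power_add)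
  qed (auto simp: join_coeff_def)
  finally show ?thesis .
qed

section \<open>Faces of simplices and products with the differential\<close>

lemma simplex_sorted: "s \<in> simplices d \<Longrightarrow> sorted_wrt (<) s"
  by (simp add: simplices_def)

lemma simplex_nonempty: "s \<in> simplices d \<Longrightarrow> 0 < length s"
  by (simp add: simplices_def)

lemma take_simplex: "s \<in> simplices d \<Longrightarrow> take (Suc i) s \<in> simplices d"
  by (auto simp: simplices_def sorted_wrt_take dest: in_set_takeD)

lemma drop_simplex: "s \<in> simplices d \<Longrightarrow> i < length s \<Longrightarrow> drop i s \<in> simplices d"
  by (auto simp: simplices_def sorted_wrt_drop dest: in_set_dropD)

lemma remove_nth_simplex:
  assumes "s \<in> simplices d" "2 \<le> length s" "j < length s"
  shows "remove_nth j s \<in> simplices d"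
proof -
  have "sorted_wrt (<) (take j s @ s ! j # drop (Suc j) s)"
    using assms by (simp add: id_take_nth_drop[symmetric] simplices_def)
  then have "sorted_wrt (<) (remove_nth j s)"
    by (auto simp: remove_nth_def sorted_wrt_append)
  moreover have "length (remove_nth j s) \<noteq> 0"
    using assms by (simp add: length_remove_nth)
  ultimately show ?thesis
    using assms by (auto simp: simplices_def remove_nth_def dest: in_set_takeD in_set_dropD)
qed

lemma sort_join_simplex:
  assumes "x \<in> simplices d" "y \<in> simplices d" "distinct (x @ y)"
  shows "sort (x @ y) \<in> simplices d"
proof -
  have "length (sort (x @ y)) \<noteq> 0" using assms by (simp add: simplices_def)
  then have "sort (x @ y) \<noteq> []" by (metis list.size(3))
  then show ?thesis using assms by (auto simp: simplices_def strict_sorted_iff)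
qed

text \<open>Passes from simplices to positions of deleted vertices, the form in which boundaries are
  compared below. The guard reflects the absence of an empty simplex: vertices are cycles.\<close>

lemma sum_bd:
  assumes "s \<in> simplices d"
  shows "(\<Sum>t\<in>simplices d. bd s t * g t)
    = (if 2 \<le> length s then \<Sum>j<length s. (-1) ^ j * g (remove_nth j s) else (0 :: 'k::comm_ring_1))"
proof (cases "2 \<le> length s")
  case True
  have "(\<Sum>t\<in>simplices d. bd s t * g t)
      = (\<Sum>j<length s. \<Sum>t\<in>simplices d. if t = remove_nth j s then (-1) ^ j * g t else 0)"
    unfolding bd_def sum_distrib_right
    by (subst sum.swap) (use True in \<open>auto intro!: sum.cong\<close>)
  also have "\<dots> = (\<Sum>j<length s. (-1) ^ j * g (remove_nth j s))"
    using True assms by (intro sum.cong refl) (simp add: finite_simplices remove_nth_simplex)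
  finally show ?thesis using True by simp
qed (simp add: bd_def)

lemma sum_basis_2: "(\<Sum>ys\<in>basis d 2. h ys) = (\<Sum>s\<in>simplices d. \<Sum>t\<in>simplices d. h [s, t])"
proof -
  have "basis d 2 = basis d (1 + 1)" by (simp add: numeral_2_eq_2)
  then show ?thesis unfolding sum_basis_append[of h d 1 1, folded \<open>basis d 2 = basis d (1 + 1)\<close>] sum_basis_1
    by simp
qed

lemma basis_single: "[s] \<in> basis d n \<longleftrightarrow> n = 1 \<and> s \<in> simplices d"
  by (auto simp: basis_def)

lemma basis_pair: "[s, t] \<in> basis d n \<longleftrightarrow> n = 2 \<and> s \<in> simplices d \<and> t \<in> simplices d"
  by (auto simp: basis_def)

lemma basis_1_cases:
  assumes "xs \<in> basis d 1" obtains s where "xs = [s]" "s \<in> simplices d"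
  using assms unfolding basis_1 by blast

lemma basis_2_cases:
  assumes "xs \<in> basis d 2" obtains s t where "xs = [s, t]" "s \<in> simplices d" "t \<in> simplices d"
  using assms by (auto simp: basis_def length_Suc_conv numeral_2_eq_2)

lemma mdiff_single: "s \<in> simplices d \<Longrightarrow> t \<in> simplices d \<Longrightarrow> mdiff d 1 [s] [t] = bd s t"
  by (simp add: mdiff_def basis_single)

lemma mdiff_pair:
  assumes "s \<in> simplices d" "t \<in> simplices d" "s' \<in> simplices d" "t' \<in> simplices d"
  shows "mdiff d 2 [s, t] [s', t']
    = (if t = t' then bd s s' else 0) + (if s = s' then (-1) ^ sdeg s * bd t t' else 0)"
  using assms by (simp add: mdiff_def basis_pair numeral_2_eq_2)

lemma mcomp_mdiff_single:
  assumes s: "s \<in> simplices d"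
  shows "mcomp d 1 F (mdiff d 1) [s] zs
    = (if 2 \<le> length s then \<Sum>j<length s. (-1) ^ j * F [remove_nth j s] zs else 0)"
  using sum_bd[OF s, of "\<lambda>t. F [t] zs"] s
  unfolding mcomp_def sum_basis_1 by (simp add: mdiff_single del: One_nat_def cong: sum.cong)

lemma mcomp_mdiff_pair:
  assumes s: "s \<in> simplices d" and t: "t \<in> simplices d"
  shows "mcomp d 2 F (mdiff d 2) [s, t] zs
    = (if 2 \<le> length s then \<Sum>j<length s. (-1) ^ j * F [remove_nth j s, t] zs else 0)
      + (-1) ^ sdeg s * (if 2 \<le> length t then \<Sum>j<length t. (-1) ^ j * F [s, remove_nth j t] zs else 0)"
proof -
  let ?S = "simplices d"
  have "mcomp d 2 F (mdiff d 2) [s, t] zs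
     = (\<Sum>s'\<in>?S. \<Sum>t'\<in>?S. (if t = t' then bd s s' * F [s', t'] zs else 0)
        + (if s = s' then (-1) ^ sdeg s * (bd t t' * F [s', t'] zs) else 0))"
    unfolding mcomp_def sum_basis_2 using s t
    by (intro sum.cong refl) (auto simp: mdiff_pair distrib_right mult.assoc)
  also have "\<dots> = (\<Sum>s'\<in>?S. \<Sum>t'\<in>?S. if t = t' then bd s s' * F [s', t'] zs else 0)
      + (\<Sum>s'\<in>?S. \<Sum>t'\<in>?S. if s = s' then (-1) ^ sdeg s * (bd t t' * F [s', t'] zs) else 0)"
    by (simp add: sum.distrib)
  also have "(\<Sum>s'\<in>?S. \<Sum>t'\<in>?S. if t = t' then bd s s' * F [s', t'] zs else 0)
      = (\<Sum>s'\<in>?S. bd s s' * F [s', t] zs)"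
    using t by (simp add: finite_simplices)
  also have "(\<Sum>s'\<in>?S. \<Sum>t'\<in>?S. if s = s' then (-1) ^ sdeg s * (bd t t' * F [s', t'] zs) else 0)
      = (-1) ^ sdeg s * (\<Sum>t'\<in>?S. bd t t' * F [s, t'] zs)"
    using s by (subst sum.swap) (simp add: finite_simplices sum_distrib_left)
  finally show ?thesis
    using sum_bd[OF s, of "\<lambda>s'. F [s', t] zs"] sum_bd[OF t, of "\<lambda>t'. F [s, t'] zs"] by simp
qed

section \<open>Degrees and boundaries of the three generators\<close>

lemma hom_el_m_eps: "hom_el d 1 0 0 (m_eps d)"
  by (auto simp: hom_el_def m_eps_def basis_def length_Suc_conv sdeg_def)

lemma hom_el_m_aw: "hom_el d 1 2 0 (m_aw d)"
  by (auto simp: hom_el_def m_aw_def basis_def length_Suc_conv numeral_2_eq_2 sdeg_def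
      take_simplex drop_simplex split: if_splits)

lemma hom_el_m_join: "hom_el d 2 1 1 (m_join d :: 'k::comm_ring_1 mat)"
  unfolding hom_el_def
proof (intro allI impI)
  fix xs ys assume nz: "(m_join d :: 'k mat) xs ys \<noteq> 0"
  then have "length xs = 2" "length ys = 1" "xs ! 0 \<in> simplices d" "xs ! 1 \<in> simplices d"
    by (auto simp: m_join_def split: if_splits)
  then obtain x y z where xy: "xs = [x, y]" "ys = [z]" "x \<in> simplices d" "y \<in> simplices d"
    by (auto simp: length_Suc_conv numeral_2_eq_2)
  with nz have z: "distinct (x @ y)" "z = sort (x @ y)"
    by (auto simp: m_join_eq join_coeff_def split: if_splits)
  with xy have "z \<in> simplices d" using sort_join_simplex by blast
  \<comment> \<open>Lengths add under the join, and each degree is one less than a length, which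
    leaves the shift by 1. Nonemptiness keeps the truncated subtraction in \<open>sdeg\<close>
    exact.\<close>
  with xy z show "xs \<in> basis d 2 \<and> ys \<in> basis d 1 \<and> tdeg ys = tdeg xs + 1"
    by (simp add: basis_single basis_pair sdeg_def Suc_leI simplex_nonempty)
      (use simplex_nonempty[of x d] simplex_nonempty[of y d] in linarith)
qed

text \<open>Only edges have vertices as faces, and their two endpoints enter with opposite
  signs.\<close>

lemma hdiff_m_eps: "hdiff d 1 0 (m_eps d) = (\<lambda>xs ys. 0 :: 'k::comm_ring_1)"
proof (rule mat_eqI)
  note h = hom_el_homp[OF hom_el_m_eps, of d]
  show "homp d d 1 0 (Suc 0) (hdiff d 1 0 (m_eps d) :: 'k mat)" by (rule homp_hdiff[OF h])
  show "homp d d 1 0 0 (\<lambda>xs ys. 0 :: 'k)" by (simp add: homp_def)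
  fix xs ys assume "xs \<in> basis d 1" "ys \<in> basis d 0"
  then obtain s where s: "xs = [s]" "s \<in> simplices d" and ys: "ys = []"
    by (auto simp: basis_0 elim!: basis_1_cases simp del: One_nat_def)
  have "mcomp d 1 (m_eps d) (mdiff d 1) [s] [] = (0 :: 'k)"
  proof (cases "length s = 2")
    case True
    then show ?thesis using s(2) unfolding mcomp_mdiff_single[OF s(2)]
      by (simp add: numeral_2_eq_2 m_eps_def remove_nth_simplex length_remove_nth)
  next
    case False
    then show ?thesis unfolding mcomp_mdiff_single[OF s(2)]
      by (auto simp: m_eps_def length_remove_nth intro!: sum.neutral)
  qed
  then show "hdiff d 1 0 (m_eps d) xs ys = (0 :: 'k)"
    unfolding hdiff_eq[OF h] s ys by (simp add: mcomp_def basis_0 mdiff_def)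
qed

text \<open>The length of the first piece determines the cut, so replacing the existential of the
  definition by a sum counts nothing twice.\<close>

lemma m_aw_eq:
  assumes "s \<in> simplices d"
  shows "m_aw d [s] [a, b] = (\<Sum>i<length s. if a = take (Suc i) s \<and> b = drop i s then 1 else 0 :: 'k::comm_ring_1)"
proof (cases "\<exists>i<length s. a = take (Suc i) s \<and> b = drop i s")
  case True
  then obtain i where i: "i < length s" "a = take (Suc i) s" "b = drop i s" by blast
  have "a = take (Suc j) s \<and> b = drop j s \<longleftrightarrow> j = i" if "j < length s" for j
    using i that by (auto dest!: arg_cong[where f = length])
  then have "(\<Sum>j<length s. if a = take (Suc j) s \<and> b = drop j s then 1 else 0 :: 'k)
      = (\<Sum>j<length s. if j = i then 1 else 0)"
    by (intro sum.cong) auto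
  then show ?thesis using True i assms by (simp add: m_aw_def)
next
  case False
  then have "(\<Sum>i<length s. if a = take (Suc i) s \<and> b = drop i s then 1 else 0 :: 'k) = 0"
    by (intro sum.neutral) auto
  then show ?thesis using False by (auto simp: m_aw_def)
qed

lemma mcomp_m_aw:
  assumes s: "s \<in> simplices d"
  shows "mcomp d 2 G (m_aw d) [s] zs = (\<Sum>i<length s. G [take (Suc i) s, drop i s] zs :: 'k::comm_ring_1)"
proof -
  let ?S = "simplices d"
  have "mcomp d 2 G (m_aw d) [s] zs
      = (\<Sum>u\<in>?S. \<Sum>v\<in>?S. \<Sum>i<length s. if u = take (Suc i) s \<and> v = drop i s then G [u, v] zs else 0)"
    unfolding mcomp_def sum_basis_2 using s
    by (intro sum.cong refl) (auto simp: m_aw_eq sum_distrib_right intro!: sum.cong)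
  also have "\<dots> = (\<Sum>i<length s. \<Sum>u\<in>?S. \<Sum>v\<in>?S. if u = take (Suc i) s \<and> v = drop i s then G [u, v] zs else 0)"
    by (rule trans[OF sum.cong[OF refl sum.swap] sum.swap])
  also have "\<dots> = (\<Sum>i<length s. G [take (Suc i) s, drop i s] zs)"
  proof (intro sum.cong refl)
    fix i assume "i \<in> {..<length s}"
    then have m: "take (Suc i) s \<in> ?S" "drop i s \<in> ?S"
      using s by (auto simp: take_simplex drop_simplex)
    have "(\<Sum>u\<in>?S. \<Sum>v\<in>?S. if u = take (Suc i) s \<and> v = drop i s then G [u, v] zs else 0)
       = (\<Sum>u\<in>?S. if u = take (Suc i) s then G [u, drop i s] zs else 0)"
      using m by (intro sum.cong refl) (simp add: finite_simplices)
    then show "(\<Sum>u\<in>?S. \<Sum>v\<in>?S. if u = take (Suc i) s \<and> v = drop i s then G [u, v] zs else 0)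
       = G [take (Suc i) s, drop i s] zs"
      using m by (simp add: finite_simplices)
  qed
  finally show ?thesis .
qed

text \<open>Faces of the pieces of a cut are either pieces of a cut face, or arise by dropping the
  shared vertex from one side only. Terms of the latter kind occur twice, for neighbouring cuts,
  with opposite signs.\<close>

lemma hdiff_m_aw: "hdiff d 1 2 (m_aw d) = (\<lambda>xs ys. 0 :: 'k::comm_ring_1)"
proof (rule mat_eqI)
  note h = hom_el_homp[OF hom_el_m_aw, of d]
  show "homp d d 1 2 (Suc 0) (hdiff d 1 2 (m_aw d) :: 'k mat)" by (rule homp_hdiff[OF h])
  show "homp d d 1 2 0 (\<lambda>xs ys. 0 :: 'k)" by (simp add: homp_def)
  fix xs ys assume xs: "xs \<in> basis d 1" and ys: "ys \<in> basis d 2"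
  obtain s where s: "xs = [s]" "s \<in> simplices d" using basis_1_cases[OF xs] .
  obtain a b where ab: "ys = [a, b]" "a \<in> simplices d" "b \<in> simplices d" using basis_2_cases[OF ys] .
  let ?S = "simplices d"
  obtain q where q: "length s = Suc q" using simplex_nonempty[OF s(2)] by (metis Suc_pred)
  \<comment> \<open>\<open>X i j\<close> and \<open>Y i j\<close> are the contributions of cut
    \<open>i\<close> with entry \<open>j\<close> deleted from the front or from the back piece. The
    front piece has degree \<open>i\<close>, hence the exponent \<open>i + j\<close> in
    \<open>Y\<close>.\<close>
  define X :: "nat \<Rightarrow> nat \<Rightarrow> 'k" where
    "X i j = (if a = remove_nth j (take (Suc i) s) \<and> b = drop i s then (-1) ^ j else 0)" for i j
  define Y :: "nat \<Rightarrow> nat \<Rightarrow> 'k" where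
    "Y i j = (if a = take (Suc i) s \<and> b = remove_nth j (drop i s) then (-1) ^ (i + j) else 0)" for i j
  have "(mcomp d 2 (mdiff d 2) (m_aw d) xs ys :: 'k) = (\<Sum>i<length s. mdiff d 2 [take (Suc i) s, drop i s] [a, b])"
    unfolding s(1) ab(1) by (rule mcomp_m_aw[OF s(2)])
  \<comment> \<open>The guards exclude pieces that are single vertices: the front one for
    \<open>i = 0\<close>, the back one for \<open>i = q\<close>.\<close>
  also have "\<dots> = (\<Sum>i<Suc q. (if 1 \<le> i then \<Sum>j<Suc i. X i j else 0) + (if i < q then \<Sum>j<Suc q - i. Y i j else 0))"
  proof (intro sum.cong)
    fix i assume "i \<in> {..<Suc q}"
    then have i: "i < length s" using q by simp
    have "(if b = drop i s then bd (take (Suc i) s) a else 0) = (if 1 \<le> i then \<Sum>j<Suc i. X i j else 0)"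
    proof -
      have "(if c then bd u a else 0)
          = (if 1 \<le> i then \<Sum>j<Suc i. if a = remove_nth j u \<and> c then (-1) ^ j else 0 else (0 :: 'k))"
        if "length u = Suc i" for u c
        using that by (auto simp: bd_def)
      then show ?thesis unfolding X_def using i by simp
    qed
    moreover have "(if a = take (Suc i) s then (-1) ^ sdeg (take (Suc i) s) * bd (drop i s) b else 0)
      = (if i < q then \<Sum>j<Suc q - i. Y i j else 0)"
    proof (cases "i < q")
      case True
      then show ?thesis
        using q by (auto simp: bd_def Y_def sdeg_def sum_distrib_left power_add min_def intro!: sum.cong)
    next
      case False
      then have "\<not> 2 \<le> length (drop i s)" using q by simp
      then show ?thesis using False by (simp add: bd_def)
    qed
    moreover have "mdiff d 2 [take (Suc i) s, drop i s] [a, b]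
        = (if drop i s = b then bd (take (Suc i) s) a else 0 :: 'k)
          + (if take (Suc i) s = a then (-1) ^ sdeg (take (Suc i) s) * bd (drop i s) b else 0)"
      by (rule mdiff_pair[OF take_simplex[OF s(2), of i] drop_simplex[OF s(2) i] ab(2,3)])
    ultimately show "mdiff d 2 [take (Suc i) s, drop i s] [a, b]
      = (if 1 \<le> i then \<Sum>j<Suc i. X i j else 0) + (if i < q then \<Sum>j<Suc q - i. Y i j else 0)"
      unfolding eq_commute[of "drop i s" b] eq_commute[of "take (Suc i) s" a] by (simp only:)
  qed (simp add: q)
  \<comment> \<open>Cut \<open>i + 1\<close> in \<open>X\<close> is aligned with cut
    \<open>i\<close> in \<open>Y\<close>, since deleting a vertex from the front shifts the cut:
    both lead to cut \<open>i\<close> of a face.\<close>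
  also have "\<dots> = (\<Sum>i<q. (\<Sum>j<Suc (Suc i). X (Suc i) j) + (\<Sum>j<Suc q - i. Y i j))"
  proof -
    have "(\<Sum>i<Suc q. if 1 \<le> i then \<Sum>j<Suc i. X i j else 0) = (\<Sum>i<q. \<Sum>j<Suc (Suc i). X (Suc i) j)"
      unfolding sum.lessThan_Suc_shift[of _ q] by (simp del: sum.lessThan_Suc)
    moreover have "(\<Sum>i<Suc q. if i < q then \<Sum>j<Suc q - i. Y i j else 0) = (\<Sum>i<q. \<Sum>j<Suc q - i. Y i j)"
      unfolding sum.lessThan_Suc[of _ q] by simp
    ultimately show ?thesis by (simp only: sum.distrib)
  qed
  also have "\<dots> = (\<Sum>i<q. \<Sum>j<Suc q. if a = take (Suc i) (remove_nth j s) \<and> b = drop i (remove_nth j s) then (-1) ^ j else 0)"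
  proof (intro sum.cong refl)
    fix i assume "i \<in> {..<q}"
    then have i: "i < q" by simp
    let ?Z = "\<lambda>j. if a = take (Suc i) (remove_nth j s) \<and> b = drop i (remove_nth j s) then (-1) ^ j else (0::'k)"
    have X: "X (Suc i) j = ?Z j" if "j < Suc i" for j
    proof -
      have "remove_nth j (take (Suc (Suc i)) s) = take (Suc i) (remove_nth j s)"
        "drop (Suc i) s = drop i (remove_nth j s)"
        using that i q by (auto simp: remove_nth_def min_def drop_take)
      then show ?thesis by (simp add: X_def)
    qed
    have Y: "Y i (Suc j) = ?Z (Suc i + j)" for j
    proof -
      have "take (Suc i) s = take (Suc i) (remove_nth (Suc i + j) s)"
        "remove_nth (Suc j) (drop i s) = drop i (remove_nth (Suc i + j) s)"
        using i q by (auto simp: remove_nth_def min_def drop_take ac_simps)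
      then show ?thesis by (simp add: Y_def)
    qed
    \<comment> \<open>The last vertex of the front piece of cut \<open>i + 1\<close> and the first
      vertex of the back piece of cut \<open>i\<close> are the shared ones; dropping them leaves the
      same pair.\<close>
    have X0: "X (Suc i) (Suc i) + Y i 0 = 0"
      using i q by (auto simp: X_def Y_def remove_nth_def min_def)
    have "(\<Sum>j<Suc (Suc i). X (Suc i) j) + (\<Sum>j<Suc q - i. Y i j)
        = (\<Sum>j<Suc i. X (Suc i) j) + (X (Suc i) (Suc i) + Y i 0) + (\<Sum>j<q - i. Y i (Suc j))"
      using i by (simp add: Suc_diff_le sum.lessThan_Suc_shift[of _ "q - i"] del: sum.lessThan_Suc)
        (simp add: ac_simps)
    also have "\<dots> = (\<Sum>j<Suc i. ?Z j) + (\<Sum>j<q - i. ?Z (Suc i + j))"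
      using X Y by (simp add: X0)
    also have "\<dots> = (\<Sum>j<Suc i + (q - i). ?Z j)" by (rule sum_lessThan_add[symmetric])
    finally show "(\<Sum>j<Suc (Suc i). X (Suc i) j) + (\<Sum>j<Suc q - i. Y i j) = (\<Sum>j<Suc q. ?Z j)"
      using i by simp
  qed
  also have "\<dots> = (\<Sum>j<Suc q. \<Sum>i<q. if a = take (Suc i) (remove_nth j s) \<and> b = drop i (remove_nth j s) then (-1) ^ j else 0)"
    by (rule sum.swap)
  also have "\<dots> = mcomp d 1 (m_aw d) (mdiff d 1) xs ys"
  proof (cases "q = 0")
    case False
    then have "remove_nth j s \<in> ?S" if "j < Suc q" for j
      using that q s by (intro remove_nth_simplex) auto
    then show ?thesis
      unfolding s(1) ab(1) mcomp_mdiff_single[OF s(2)] using False q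
      by (auto simp: m_aw_eq length_remove_nth sum_distrib_left simp del: sum.lessThan_Suc intro!: sum.cong)
  next
    case True
    then show ?thesis unfolding s(1) mcomp_mdiff_single[OF s(2)] using q by simp
  qed
  finally show "hdiff d 1 2 (m_aw d) xs ys = (0 :: 'k)"
    unfolding hdiff_eq[OF h] by simp
qed

lemma join_coeff_sorted:
  assumes "sorted_wrt (<) l"
  shows "join_coeff l z = (if z = l then 1 else 0)"
  using assms by (auto simp: join_coeff_def strict_sorted_iff inversions_sorted sorted_sort_id)

lemma simplex_length_ge_2: "s \<in> simplices d \<Longrightarrow> 2 \<le> length s \<longleftrightarrow> length s \<noteq> 1"
  using simplex_nonempty[of s d] by linarith

lemma boundary_join:
  "(\<Sum>i<length l. (-1) ^ i * join_coeff (remove_nth i l) z)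
    = (if distinct l then (-1) ^ inversions l * (\<Sum>j<length l. if z = remove_nth j (sort l) then (-1) ^ j else 0)
       else 0 :: 'k::comm_ring_1)"
  using boundary_join_distinct[of l z] boundary_join_not_distinct[of l z] by auto

lemma m_join_eq_0:
  assumes x: "x \<in> simplices d" and y: "y \<in> simplices d" and ws: "ws \<in> basis d 1"
    and ne: "\<not> distinct (x @ y) \<or> ws \<noteq> [sort (x @ y)]"
  shows "m_join d [x, y] ws = 0"
proof -
  obtain t where "ws = [t]" using basis_1_cases[OF ws] .
  then show ?thesis using ne by (simp only: m_join_eq[OF x y]) (auto simp: join_coeff_def)
qed

text \<open>Let \<open>Sx\<close> and \<open>Sy\<close> be the parts of the exterior boundary of
  \<open>x @ y\<close> that delete from \<open>x\<close> and from \<open>y\<close>. The boundary of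
  the join gives \<open>(-1) ^ sdeg x * Sx - Sy\<close>; the join of the boundary cancels
  \<open>Sx\<close> unless \<open>x\<close> is a vertex, and \<open>Sy\<close> unless
  \<open>y\<close> is one.\<close>

lemma hdiff_m_join:
  "hdiff d 2 1 (m_join d)
    = (\<lambda>xs ys. mtens 1 0 (m_eps d) (m_id d 1) xs ys - (mtens 1 1 (m_id d 1) (m_eps d) xs ys :: 'k::comm_ring_1))"
proof (rule mat_eqI)
  note h = hom_el_homp[OF hom_el_m_join, of d]
  note I = hom_el_homp[OF hom_el_m_id] and E = hom_el_homp[OF hom_el_m_eps]
  show "homp d d 2 1 (Suc 1) (hdiff d 2 1 (m_join d) :: 'k mat)" by (rule homp_hdiff[OF h])
  have "homp d d (1 + 1) (0 + 1) (0 + 0) (mtens 1 0 (m_eps d) (m_id d 1) :: 'k mat)"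
    by (intro homp_mtens E I)
  moreover have "homp d d (1 + 1) (1 + 0) (0 + 0) (mtens 1 1 (m_id d 1) (m_eps d) :: 'k mat)"
    by (intro homp_mtens E I)
  ultimately show "homp d d 2 1 0 (\<lambda>xs ys. mtens 1 0 (m_eps d) (m_id d 1) xs ys
      - (mtens 1 1 (m_id d 1) (m_eps d) xs ys :: 'k))"
    by (intro homp_diff) (simp_all add: numeral_2_eq_2)
  fix xs ys assume xs: "xs \<in> basis d 2" and ys: "ys \<in> basis d 1"
  obtain x y where x: "x \<in> simplices d" and y: "y \<in> simplices d" and xy: "xs = [x, y]"
    using basis_2_cases[OF xs] by metis
  obtain z where z: "ys = [z]" "z \<in> simplices d" using basis_1_cases[OF ys] .
  let ?l = "x @ y"
  define Sx Sy :: 'k where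
    "Sx = (\<Sum>j<length x. (-1) ^ j * join_coeff (remove_nth j x @ y) z)" and
    "Sy = (\<Sum>j<length y. (-1) ^ j * join_coeff (x @ remove_nth j y) z)"
  have "(\<Sum>i<length ?l. (-1) ^ i * join_coeff (remove_nth i ?l) z) = Sx + (-1) ^ length x * Sy"
    unfolding Sx_def Sy_def length_append sum_lessThan_add
    by (simp add: remove_nth_append1 remove_nth_append2 power_add sum_distrib_left mult.assoc)
  \<comment> \<open>The exterior boundary counts vertices, one more than the degree; this turns the
    sum of the two parts into a difference.\<close>
  also have "(-1) ^ length x = - ((-1) ^ sdeg x :: 'k)"
    using simplex_nonempty[OF x] by (cases "length x") (auto simp: sdeg_def)
  finally have bdry: "(if distinct ?l then (-1) ^ inversions ?l * (\<Sum>j<length ?l. if z = remove_nth j (sort ?l) then (-1) ^ j else 0) else 0)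
      = Sx - (-1) ^ sdeg x * Sy"
    unfolding boundary_join by simp
  \<comment> \<open>A join has at least two vertices, so its boundary is the full alternating
    sum.\<close>
  have L: "2 \<le> length ?l" using simplex_nonempty[OF x] simplex_nonempty[OF y] unfolding length_append by linarith
  have DF: "mcomp d 1 (mdiff d 1) (m_join d) xs ys = (-1) ^ sdeg x * (Sx - (-1) ^ sdeg x * Sy)"
  proof (cases "distinct ?l")
    case True
    then have m: "sort ?l \<in> simplices d" by (rule sort_join_simplex[OF x y])
    have "mcomp d 1 (mdiff d 1) (m_join d) xs ys = m_join d xs [sort ?l] * (mdiff d 1 [sort ?l] ys :: 'k)"
    proof (rule mcomp_single)
      show "[sort ?l] \<in> basis d 1" using m by (simp add: basis_single)
      show "m_join d xs ws = 0" if "ws \<in> basis d 1" "ws \<noteq> [sort ?l]" for ws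
        unfolding xy using that by (intro m_join_eq_0[OF x y]) auto
    qed
    also have "\<dots> = (-1) ^ sdeg x * ((-1) ^ inversions ?l * bd (sort ?l) z)"
      using True by (simp only: xy z mdiff_single[OF m z(2)] m_join_eq[OF x y]) (simp add: join_coeff_def)
    also have "bd (sort ?l) z = (\<Sum>j<length ?l. if z = remove_nth j (sort ?l) then (-1) ^ j else 0 :: 'k)"
      using L by (auto simp: bd_def intro!: sum.cong)
    finally show ?thesis using bdry True by simp
  next
    case False
    have "m_join d xs ws = (0 :: 'k)" if "ws \<in> basis d 1" for ws
      unfolding xy using that False by (intro m_join_eq_0[OF x y]) auto
    moreover have "Sx - (-1) ^ sdeg x * Sy = 0"
      unfolding bdry[symmetric] using False by (simp only: if_False)
    ultimately show ?thesis by (simp add: mcomp_def)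
  qed
  have FD: "mcomp d 2 (m_join d) (mdiff d 2) xs ys
      = (if 2 \<le> length x then - ((-1) ^ sdeg x * Sx) else 0) + (if 2 \<le> length y then Sy else 0)"
  proof -
    \<comment> \<open>A face of \<open>x\<close> has degree one lower, so the prefactor of the join
      changes sign.\<close>
    have 1: "(\<Sum>j<length x. (-1) ^ j * m_join d [remove_nth j x, y] [z]) = - ((-1) ^ sdeg x * Sx)" if "2 \<le> length x"
    proof -
      have "m_join d [remove_nth j x, y] [z] = - ((-1) ^ sdeg x * join_coeff (remove_nth j x @ y) z :: 'k)"
        if j: "j < length x" for j
      proof -
        have "sdeg x = Suc (sdeg (remove_nth j x))"
          using j \<open>2 \<le> length x\<close> by (simp add: sdeg_def length_remove_nth)
        then show ?thesis
          using j \<open>2 \<le> length x\<close> by (simp add: m_join_eq[OF remove_nth_simplex[OF x] y])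
      qed
      then show ?thesis by (simp add: Sx_def sum_distrib_left sum_negf[symmetric] ac_simps)
    qed
    \<comment> \<open>The Koszul sign of the differential past \<open>x\<close> cancels the
      prefactor of the join.\<close>
    have 2: "(-1) ^ sdeg x * (\<Sum>j<length y. (-1) ^ j * m_join d [x, remove_nth j y] [z]) = Sy" if "2 \<le> length y"
    proof -
      have "m_join d [x, remove_nth j y] [z] = (-1) ^ sdeg x * (join_coeff (x @ remove_nth j y) z :: 'k)"
        if j: "j < length y" for j
        using j \<open>2 \<le> length y\<close> by (simp add: m_join_eq[OF x remove_nth_simplex[OF y]])
      then have "(\<Sum>j<length y. (-1) ^ j * m_join d [x, remove_nth j y] [z]) = (-1) ^ sdeg x * Sy"
        by (simp add: Sy_def sum_distrib_left ac_simps)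
      then show ?thesis by (simp add: minus_one_power_mult_self)
    qed
    show ?thesis
      unfolding xy z(1) mcomp_mdiff_pair[OF x y] using 1 2 by auto
  qed
  have ex: "mtens 1 0 (m_eps d) (m_id d 1) xs ys = (if length x = 1 \<and> y = z then 1 else 0 :: 'k)"
    using x y z by (auto simp: xy mtens_def m_eps_def m_id_def basis_single sdeg_def)
  have ey: "mtens 1 1 (m_id d 1) (m_eps d) xs ys = (if x = z \<and> length y = 1 then 1 else 0 :: 'k)"
    using x y z by (auto simp: xy mtens_def m_eps_def m_id_def basis_single sdeg_def)
  \<comment> \<open>Deleting the only vertex of \<open>x\<close> leaves \<open>y\<close>, already
    sorted: the entry of the augmentation tensored with the identity.\<close>
  have Sx1: "Sx = (if y = z then 1 else 0)" if "length x = 1"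
    using that simplex_sorted[OF y] by (auto simp: Sx_def remove_nth_def join_coeff_sorted)
  have Sy1: "Sy = (if x = z then 1 else 0)" if "length y = 1"
    using that simplex_sorted[OF x] by (auto simp: Sy_def remove_nth_def join_coeff_sorted)
  have "hdiff d 2 1 (m_join d) xs ys
     = (if 2 \<le> length x then 0 else (-1) ^ sdeg x * Sx) - (if 2 \<le> length y then 0 else Sy)"
    unfolding hdiff_eq[OF h] using DF FD by (simp add: right_diff_distrib minus_one_power_mult_self)
  also have "\<dots> = (if length x = 1 then Sx else 0) - (if length y = 1 then Sy else 0)"
    by (simp add: simplex_length_ge_2[OF x] simplex_length_ge_2[OF y] sdeg_def)
  also have "\<dots> = mtens 1 0 (m_eps d) (m_id d 1) xs ys - mtens 1 1 (m_id d 1) (m_eps d) xs ys"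
    unfolding ex ey using Sx1 Sy1 by (cases "length x = 1"; cases "length y = 1") simp_all
  finally show "hdiff d 2 1 (m_join d) xs ys
      = mtens 1 0 (m_eps d) (m_id d 1) xs ys - (mtens 1 1 (m_id d 1) (m_eps d) xs ys :: 'k)" .
qed

section \<open>Naturality in the simplex\<close>

locale order_map =
  fixes d e :: nat and f :: "nat \<Rightarrow> nat"
  assumes mono: "mono_on {0..d} f" and range: "f ` {0..d} \<subseteq> {0..e}"
begin

text \<open>A weakly increasing map reflects the strict order wherever the images differ, which is
  the case inside nondegenerate images.\<close>

lemma less_iff:
  assumes "x \<le> d" "y \<le> d" "f x \<noteq> f y"
  shows "f x < f y \<longleftrightarrow> x < y"
  using mono_onD[OF mono, of x y] mono_onD[OF mono, of y x] assms
  by (cases x y rule: linorder_cases) auto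

lemma simplex_bound: "s \<in> simplices d \<Longrightarrow> x \<in> set s \<Longrightarrow> x \<le> d"
  by (auto simp: simplices_def)

lemma sorted_map: "sorted l \<Longrightarrow> set l \<subseteq> {0..d} \<Longrightarrow> sorted (map f l)"
  by (induction l) (auto intro: mono_onD[OF mono])

lemma map_simplex:
  assumes "s \<in> simplices d" "distinct (map f s)"
  shows "map f s \<in> simplices e"
  using assms sorted_map[of s] range
  by (auto simp: simplices_def strict_sorted_iff)

lemma map_basis:
  assumes "xs \<in> basis d n" "\<forall>s\<in>set xs. distinct (map f s)"
  shows "map (map f) xs \<in> basis e n"
  using assms map_simplex by (auto simp: basis_def)

lemma tdeg_map: "tdeg (map (map f) xs) = tdeg xs"
  by (induction xs) (auto simp: sdeg_def)

lemma homp_fpow: "homp d e n n 0 (fpow d f n)"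
  by (auto simp: homp_def fpow_def map_basis tdeg_map split: if_splits)

lemma fpow_add: "fpow d f (n + m) = (mtens n n (fpow d f n) (fpow d f m) :: 'k::comm_ring_1 mat)"
proof (rule mat_eqI)
  show "homp d e (n + m) (n + m) 0 (fpow d f (n + m) :: 'k mat)" by (rule homp_fpow)
  show "homp d e (n + m) (n + m) (0 + 0) (mtens n n (fpow d f n) (fpow d f m) :: 'k mat)"
    by (intro homp_mtens homp_fpow)
  fix xs ys assume xs: "xs \<in> basis d (n + m)" and ys: "ys \<in> basis e (n + m)"
  obtain x x' where x: "xs = x @ x'" "x \<in> basis d n" "x' \<in> basis d m" using basis_split[OF xs] .
  obtain y y' where y: "ys = y @ y'" "y \<in> basis e n" "y' \<in> basis e m" using basis_split[OF ys] .
  have l: "length x = n" "length y = n" using x y by (auto simp: basis_length)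
  have "tdeg y' = tdeg x'" if "y' = map (map f) x'" using that by (simp add: tdeg_map)
  moreover have "ys = map (map f) xs \<longleftrightarrow> y = map (map f) x \<and> y' = map (map f) x'"
    using l by (simp add: x y)
  ultimately show "fpow d f (n + m) xs ys = (mtens n n (fpow d f n) (fpow d f m) xs ys :: 'k)"
    using xs x y l by (auto simp: mtens_append fpow_def minus_one_power_iff)
qed

lemma mcomp_fpow:
  assumes "xs \<in> basis d n"
  shows "mcomp e n G (fpow d f n) xs zs
    = (if \<forall>s\<in>set xs. distinct (map f s) then G (map (map f) xs) zs else (0 :: 'k::comm_ring_1))"
proof (cases "\<forall>s\<in>set xs. distinct (map f s)")
  case True
  have "mcomp e n G (fpow d f n) xs zs = fpow d f n xs (map (map f) xs) * G (map (map f) xs) zs"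
    by (rule mcomp_single) (use assms True map_basis in \<open>auto simp: fpow_def\<close>)
  then show ?thesis using True assms by (simp add: fpow_def)
next
  case False
  then have "fpow d f n xs ys = (0 :: 'k)" for ys by (auto simp: fpow_def)
  then have "mcomp e n G (fpow d f n) xs zs = 0" by (simp add: mcomp_def)
  with False show ?thesis by (simp only: if_False)
qed

text \<open>Nondegenerate images keep their dimension, and a degenerate image comes from a simplex
  of positive dimension, which the augmentation kills.\<close>

lemma natural_eps:
  "mcomp d 0 (fpow d f 0) (m_eps d) = (mcomp e 1 (m_eps e) (fpow d f 1) :: 'k::comm_ring_1 mat)"
proof (rule mat_eqI)
  show "homp d e 1 0 (0 + 0) (mcomp d 0 (fpow d f 0) (m_eps d) :: 'k mat)"
    by (intro homp_mcomp homp_fpow hom_el_homp hom_el_m_eps)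
  show "homp d e 1 0 (0 + 0) (mcomp e 1 (m_eps e) (fpow d f 1) :: 'k mat)"
    by (intro homp_mcomp homp_fpow hom_el_homp hom_el_m_eps)
  fix xs ys assume xs: "xs \<in> basis d 1" and ys: "ys \<in> basis e 0"
  obtain s where s: "xs = [s]" "s \<in> simplices d" using basis_1_cases[OF xs] .
  have "distinct (map f s)" if "length s = 1"
    using that by (cases s) auto
  then show "mcomp d 0 (fpow d f 0) (m_eps d) xs ys = (mcomp e 1 (m_eps e) (fpow d f 1) xs ys :: 'k)"
    using ys s unfolding mcomp_fpow[OF xs]
    by (auto simp: mcomp_def basis_0 fpow_def m_eps_def map_simplex)
qed

text \<open>The substance lies in the degenerate case: if \<open>f\<close> collapses
  \<open>s\<close>, it must collapse one of the two pieces of every cut.\<close>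

lemma natural_aw:
  "mcomp d 2 (fpow d f 2) (m_aw d) = (mcomp e 1 (m_aw e) (fpow d f 1) :: 'k::comm_ring_1 mat)"
proof (rule mat_eqI)
  show "homp d e 1 2 (0 + 0) (mcomp d 2 (fpow d f 2) (m_aw d) :: 'k mat)"
    by (intro homp_mcomp homp_fpow hom_el_homp hom_el_m_aw)
  show "homp d e 1 2 (0 + 0) (mcomp e 1 (m_aw e) (fpow d f 1) :: 'k mat)"
    by (intro homp_mcomp homp_fpow hom_el_homp hom_el_m_aw)
  fix xs ys assume xs: "xs \<in> basis d 1" and ys: "ys \<in> basis e 2"
  obtain s where s: "xs = [s]" "s \<in> simplices d" using basis_1_cases[OF xs] .
  obtain a b where ab: "ys = [a, b]" using basis_2_cases[OF ys] by metis
  have t: "[take (Suc i) s, drop i s] \<in> basis d 2" if "i < length s" for i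
    using s that by (simp add: basis_pair take_simplex drop_simplex)
  show "mcomp d 2 (fpow d f 2) (m_aw d) xs ys = (mcomp e 1 (m_aw e) (fpow d f 1) xs ys :: 'k)"
  proof (cases "distinct (map f s)")
    case True
    then have "distinct (map f (take (Suc i) s))" "distinct (map f (drop i s))" for i
      by (simp_all add: take_map[symmetric] drop_map[symmetric])
    then have "fpow d f 2 [take (Suc i) s, drop i s] [a, b]
        = (if a = take (Suc i) (map f s) \<and> b = drop i (map f s) then 1 else 0 :: 'k)" if "i < length s" for i
      using t[OF that] by (simp add: fpow_def take_map drop_map)
    then have "mcomp d 2 (fpow d f 2) (m_aw d) xs ys = (m_aw e [map f s] [a, b] :: 'k)"
      unfolding s(1) ab mcomp_m_aw[OF s(2)] m_aw_eq[OF map_simplex[OF s(2) True]] by simp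
    then show ?thesis using True unfolding mcomp_fpow[OF xs] by (simp add: s ab)
  next
    case False
    have "fpow d f 2 [take (Suc i) s, drop i s] [a, b] = (0 :: 'k)" if i: "i < length s" for i
    proof -
      have "\<not> (distinct (map f (take (Suc i) s)) \<and> distinct (map f (drop i s)))"
      proof
        assume "distinct (map f (take (Suc i) s)) \<and> distinct (map f (drop i s))"
        moreover define u c v where "u = take i s" and "c = s ! i" and "v = drop (Suc i) s"
        ultimately have D': "distinct (map f (take (Suc i) s))" "distinct (map f (drop i s))"
          by auto
        have su: "s = u @ c # v" "take (Suc i) s = u @ [c]" "drop i s = c # v"
          using i by (auto simp: u_def c_def v_def id_take_nth_drop take_Suc_conv_app_nth Cons_nth_drop_Suc)
        have D: "distinct (map f (u @ [c]))" "distinct (map f (c # v))"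
          using D' by (simp_all only: su(2,3))
        have sorted: "sorted_wrt (<) (u @ c # v)" using simplex_sorted[OF s(2)] su(1) by simp
        \<comment> \<open>The shared vertex \<open>c\<close> separates the pieces:
          \<open>f x\<close> is strictly below \<open>f c\<close>, which is at most
          \<open>f y\<close>. So two nondegenerate pieces would make the whole image
          nondegenerate.\<close>
        have "f x \<noteq> f y" if "x \<in> set u" "y \<in> set v" for x y
        proof -
          have "x \<le> c" "c \<le> y" using sorted that by (auto simp: sorted_wrt_append)
          moreover have "x \<le> d" "y \<le> d" "c \<le> d"
            using simplex_bound[OF s(2)] that su(1) by auto
          ultimately have "f x \<le> f c" "f c \<le> f y"
            by (auto intro!: mono_onD[OF mono])
          moreover have "f x \<noteq> f c" using D(1) that by (auto simp: image_iff)
          ultimately show ?thesis by simp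
        qed
        then have "set (map f u) \<inter> set (map f v) = {}" by auto
        then have "distinct (map f s)" using D unfolding su(1) by auto
        with False show False ..
      qed
      then show ?thesis by (auto simp: fpow_def)
    qed
    then have "mcomp d 2 (fpow d f 2) (m_aw d) xs ys = (0 :: 'k)"
      unfolding s(1) ab mcomp_m_aw[OF s(2)] by simp
    then show ?thesis using False unfolding mcomp_fpow[OF xs] by (simp add: s)
  qed
qed

lemma inversions_map:
  "distinct (map f l) \<Longrightarrow> set l \<subseteq> {0..d} \<Longrightarrow> inversions (map f l) = inversions l"
proof (induction l)
  case (Cons x l)
  have "filter (\<lambda>y. f y < f x) l = filter (\<lambda>y. y < x) l"
  proof (intro filter_cong refl less_iff)
    fix y assume "y \<in> set l"
    then show "y \<le> d" "x \<le> d" "f y \<noteq> f x"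
      using Cons.prems by (auto simp: image_iff)
  qed
  then show ?case using Cons by (simp add: filter_map o_def)
qed simp

text \<open>A sorted list is determined by its multiset, even when \<open>f\<close> identifies
  vertices.\<close>

lemma sort_map: "set l \<subseteq> {0..d} \<Longrightarrow> sort (map f l) = map f (sort l)"
  by (rule properties_for_sort) (simp_all add: sorted_map)

text \<open>Both sides equal \<open>(-1) ^ sdeg x * join_coeff (map f (x @ y)) z\<close>. The value
  0 of \<open>join_coeff\<close> on repetitions covers a common vertex of \<open>x\<close> and
  \<open>y\<close> as well as distinct vertices with the same image.\<close>

lemma natural_join:
  "mcomp d 1 (fpow d f 1) (m_join d) = (mcomp e 2 (m_join e) (fpow d f 2) :: 'k::comm_ring_1 mat)"
proof (rule mat_eqI)
  show "homp d e 2 1 (1 + 0) (mcomp d 1 (fpow d f 1) (m_join d) :: 'k mat)"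
    by (intro homp_mcomp homp_fpow hom_el_homp hom_el_m_join)
  show "homp d e 2 1 (0 + 1) (mcomp e 2 (m_join e) (fpow d f 2) :: 'k mat)"
    by (intro homp_mcomp homp_fpow hom_el_homp hom_el_m_join)
  fix xs ys assume xs: "xs \<in> basis d 2" and ys: "ys \<in> basis e 1"
  obtain x y where x: "x \<in> simplices d" and y: "y \<in> simplices d" and xy: "xs = [x, y]"
    using basis_2_cases[OF xs] by metis
  obtain z where z: "ys = [z]" using basis_1_cases[OF ys] by metis
  let ?l = "x @ y"
  have sl: "set ?l \<subseteq> {0..d}" using x y by (auto simp: simplices_def)
  have L: "mcomp d 1 (fpow d f 1) (m_join d) xs ys
    = (if distinct (map f ?l) then (-1) ^ sdeg x * join_coeff (map f ?l) z else 0 :: 'k)"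
  proof (cases "distinct ?l")
    case True
    then have m: "sort ?l \<in> simplices d" by (rule sort_join_simplex[OF x y])
    have "mcomp d 1 (fpow d f 1) (m_join d) xs ys = m_join d xs [sort ?l] * (fpow d f 1 [sort ?l] ys :: 'k)"
    proof (rule mcomp_single)
      show "[sort ?l] \<in> basis d 1" using m by (simp add: basis_single)
      show "m_join d xs ws = 0" if "ws \<in> basis d 1" "ws \<noteq> [sort ?l]" for ws
        unfolding xy using that by (intro m_join_eq_0[OF x y]) auto
    qed
    also have "m_join d xs [sort ?l] = ((-1) ^ sdeg x * (-1) ^ inversions ?l :: 'k)"
      using True by (simp only: xy m_join_eq[OF x y]) (simp add: join_coeff_def)
    also have "fpow d f 1 [sort ?l] ys = (if distinct (map f ?l) \<and> z = sort (map f ?l) then 1 else 0 :: 'k)"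
    proof -
      have "distinct (map f (sort ?l)) \<longleftrightarrow> distinct (map f ?l)"
        unfolding sort_map[OF sl, symmetric] by simp
      moreover have "[sort ?l] \<in> basis d 1" using m by (simp add: basis_single)
      ultimately show ?thesis
        unfolding z fpow_def sort_map[OF sl] by (simp del: map_append)
    qed
    finally show ?thesis
      using inversions_map[OF _ sl] by (simp add: join_coeff_def del: map_append)
  next
    case False
    have "m_join d xs ws = (0 :: 'k)" if "ws \<in> basis d 1" for ws
      unfolding xy using that False by (intro m_join_eq_0[OF x y]) auto
    moreover have "\<not> distinct (map f ?l)" using False by (auto simp: distinct_map)
    ultimately show ?thesis by (simp add: mcomp_def del: map_append)
  qed
  show "mcomp d 1 (fpow d f 1) (m_join d) xs ys = (mcomp e 2 (m_join e) (fpow d f 2) xs ys :: 'k)"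
  proof (cases "distinct (map f x) \<and> distinct (map f y)")
    case True
    then have "m_join e [map f x, map f y] [z] = ((-1) ^ sdeg x * join_coeff (map f ?l) z :: 'k)"
      using x y by (simp add: m_join_eq map_simplex sdeg_def)
    then show ?thesis
      unfolding L mcomp_fpow[OF xs] using True by (auto simp: xy z join_coeff_def)
  next
    case False
    then show ?thesis
      unfolding L mcomp_fpow[OF xs] by (auto simp: xy)
  qed
qed

lemma natural_tau:
  "mcomp d 2 (fpow d f 2) (m_tau d) = (mcomp e 2 (m_tau e) (fpow d f 2) :: 'k::comm_ring_1 mat)"
proof -
  have h: "homp d e 1 1 0 (fpow d f 1 :: 'k mat)" by (rule homp_fpow)
  show ?thesis
    using swapm_natural[OF h h] by (simp only: m_tau_swapm one_add_one[symmetric] fpow_add) simp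
qed

end

section \<open>Evaluation of expressions\<close>

lemma idn_typing [simp]: "src (idn n) = n" "tgt (idn n) = n" "wt (idn n)" "deg (idn n) = 0"
  by (induction n) auto

lemma bswap1_typing [simp]: "src (bswap1 n) = Suc n" "tgt (bswap1 n) = Suc n" "wt (bswap1 n)"
  by (induction n) auto

lemma bswap_typing [simp]: "src (bswap n m) = n + m" "tgt (bswap n m) = m + n" "wt (bswap n m)"
  by (induction n) auto

lemma ev_idn: "ev d (idn n) = m_id d n"
proof (induction n)
  case (Suc n)
  then show ?case using mtens_id[of 1 d n] by simp
qed simp

text \<open>The recursion is the first hexagon for one factor moving past \<open>1 + n\<close>
  others.\<close>

lemma ev_bswap1: "ev d (bswap1 n) = swapm d 1 n"
proof (induction n)
  case (Suc n)
  then show ?case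
    using swapm_hexagon1[of d 1 1 n] by (simp add: ev_idn m_tau_swapm numeral_2_eq_2)
qed (simp add: swapm_0_right)

text \<open>The recursion is the second hexagon, splitting one factor off the left block.\<close>

lemma ev_bswap: "ev d (bswap n m) = swapm d n m"
proof (induction n)
  case (Suc n)
  then show ?case
    using swapm_hexagon2[of d 1 m n] by (simp add: ev_idn ev_bswap1)
qed (simp add: ev_idn swapm_0_left)

lemma hom_el_ev: "wt x \<Longrightarrow> hom_el d (src x) (tgt x) (deg x) (ev d x)"
proof (induction x)
  case (Gen g)
  then show ?case
    using hom_el_m_eps hom_el_m_aw hom_el_m_join by (cases g) auto
next
  case Tau
  then show ?case using hom_el_swapm[of d 1 1] by (simp add: m_tau_swapm numeral_2_eq_2)
qed (auto simp: hom_el_mtens hom_el_m_id intro: hom_el_mcomp simp del: One_nat_def)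

lemmas homp_ev = hom_el_homp[OF hom_el_ev]

section \<open>Linear combinations of expressions\<close>

lemma ev_comb_Nil [simp]: "ev_comb d [] = (\<lambda>xs ys. 0)"
  by (simp add: ev_comb_def)

lemma ev_comb_Cons [simp]: "ev_comb d ((r, t) # c) = (\<lambda>xs ys. r * ev d t xs ys + ev_comb d c xs ys)"
  by (simp add: ev_comb_def)

lemma ev_comb_append [simp]: "ev_comb d (c @ c') = (\<lambda>xs ys. ev_comb d c xs ys + ev_comb d c' xs ys)"
  by (simp add: ev_comb_def)

lemma ev_comb_smult [simp]: "ev_comb d (smult_comb r c) = (\<lambda>xs ys. r * ev_comb d c xs ys)"
proof (induction c)
  case (Cons p c)
  then show ?case by (cases p) (simp add: smult_comb_def algebra_simps)
qed (simp add: smult_comb_def)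

lemma map_comb_simps [simp]: "map_comb h [] = []" "map_comb h ((r, t) # c) = (r, h t) # map_comb h c"
  by (simp_all add: map_comb_def)

lemma ev_comb_Comp_right:
  "ev_comb d (map_comb (\<lambda>t. Comp t e) c) = mcomp d (tgt e) (ev_comb d c) (ev d e)"
proof (induction c)
  case (Cons p c)
  then show ?case by (cases p) (simp add: mcomp_add_left mcomp_scale_left)
qed (simp add: fun_eq_iff mcomp_def)

text \<open>Evaluating \<open>Comp e t\<close> sums over the basis of arity \<open>tgt t\<close>; a
  common value is required to take that sum outside the combination.\<close>

lemma ev_comb_Comp_left:
  "\<forall>(r, t)\<in>set c. tgt t = k \<Longrightarrow> ev_comb d (map_comb (\<lambda>t. Comp e t) c) = mcomp d k (ev d e) (ev_comb d c)"
proof (induction c)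
  case (Cons p c)
  then show ?case by (cases p) (simp add: mcomp_add_right mcomp_scale_right)
qed (simp add: fun_eq_iff mcomp_def)

lemma mtens_add_left:
  "mtens n m (\<lambda>xs ys. F xs ys + G xs ys) H = (\<lambda>xs ys. mtens n m F H xs ys + mtens n m G H xs ys)"
  by (simp add: fun_eq_iff mtens_def algebra_simps)

lemma mtens_add_right:
  "mtens n m F (\<lambda>xs ys. G xs ys + H xs ys) = (\<lambda>xs ys. mtens n m F G xs ys + mtens n m F H xs ys)"
  by (simp add: fun_eq_iff mtens_def algebra_simps)

lemma ev_comb_Tens_left:
  "ev_comb d (map_comb (\<lambda>t. Tens e t) c) = mtens (src e) (tgt e) (ev d e) (ev_comb d c)"
proof (induction c)
  case (Cons p c)
  then show ?case by (cases p) (simp add: mtens_add_right mtens_scale_right)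
qed (simp add: fun_eq_iff mtens_def)

lemma ev_comb_Tens_right:
  "\<forall>(r, t)\<in>set c. src t = n \<and> tgt t = m \<Longrightarrow>
    ev_comb d (map_comb (\<lambda>t. Tens t e) c) = mtens n m (ev_comb d c) (ev d e)"
proof (induction c)
  case (Cons p c)
  then show ?case by (cases p) (simp add: mtens_add_left mtens_scale_left)
qed (simp add: fun_eq_iff mtens_def)

text \<open>Supplies the common arities under which the differential of a composite can be evaluated
  termwise.\<close>

lemma dS_typing:
  "wt x \<Longrightarrow> \<forall>(r, t)\<in>set (dS x). wt t \<and> src t = src x \<and> tgt t = tgt x"
proof (induction x)
  case (Gen g)
  then show ?case by (cases g) auto
qed (fastforce simp: map_comb_def smult_comb_def)+

text \<open>Both \<open>dS\<close> and \<open>hdiff\<close> are derivations with the same sign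
  \<open>(-1) ^ deg a\<close>, so agreement on generators and on the symmetry propagates.\<close>

lemma ev_dS:
  "wt x \<Longrightarrow> ev_comb d (dS x) = hdiff d (src x) (tgt x) (ev d x :: 'k::comm_ring_1 mat)"
proof (induction x)
  case (Gen g)
  have "hdiff d 1 0 (m_eps d :: 'k mat) = (\<lambda>xs ys. 0)" "hdiff d 1 2 (m_aw d :: 'k mat) = (\<lambda>xs ys. 0)"
    "hdiff d 2 1 (m_join d :: 'k mat)
      = (\<lambda>xs ys. mtens 1 0 (m_eps d) (m_id d 1) xs ys - mtens 1 1 (m_id d 1) (m_eps d) xs ys)"
    by (rule hdiff_m_eps hdiff_m_aw hdiff_m_join)+
  then show ?case by (cases g) auto
next
  case Tau
  have "hdiff d (1 + 1) (1 + 1) (swapm d 1 1 :: 'k mat) = (\<lambda>xs ys. 0)" by (rule hdiff_swapm)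
  then show ?case by (simp add: m_tau_swapm numeral_2_eq_2)
next
  case (Comp a b)
  then have w: "wt a" "wt b" "src a = tgt b" by auto
  have "\<forall>(r, t)\<in>set (dS b :: 'k comb). tgt t = tgt b" using dS_typing[OF w(2)] by auto
  then show ?case
    using Comp.IH w hdiff_mcomp[OF homp_ev[OF w(2)] homp_ev[OF w(1), unfolded w(3)], where 'a = 'k, of d]
    by (simp add: ev_comb_Comp_left ev_comb_Comp_right)
next
  case (Tens a b)
  then have w: "wt a" "wt b" by auto
  have "\<forall>(r, t)\<in>set (dS a :: 'k comb). src t = src a \<and> tgt t = tgt a" using dS_typing[OF w(1)] by auto
  then show ?case
    using Tens.IH w hdiff_mtens[OF homp_ev[OF w(1)] homp_ev[OF w(2)], where 'k = 'k, of d]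
    by (simp add: ev_comb_Tens_left ev_comb_Tens_right)
qed (simp_all add: hdiff_m_id del: One_nat_def)

text \<open>The combinations in \<open>Irel\<close> may mix different arities, so the arity
  of the left factor is recovered by summing over all splittings.\<close>

lemma ev_Tens_split:
  assumes "wt t"
  shows "ev d (Tens t e) xs ys
    = (\<Sum>n\<le>length xs. \<Sum>m\<le>length ys. mtens n m (ev d t) (ev d e) xs ys :: 'k::comm_ring_1)"
proof -
  let ?G = "\<lambda>n m. mtens n m (ev d t) (ev d e) xs ys :: 'k"
  have z: "?G n m = 0" if "length (take n xs) \<noteq> src t \<or> length (take m ys) \<noteq> tgt t" for n m
  proof -
    have "ev d t (take n xs) (take m ys) = (0 :: 'k)"
      by (rule homp_zero[OF homp_ev[OF assms]]) (use that basis_length in blast)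
    then show ?thesis by (simp add: mtens_def)
  qed
  have "(\<Sum>n\<le>length xs. \<Sum>m\<le>length ys. ?G n m)
      = (\<Sum>n\<le>length xs. \<Sum>m\<le>length ys. if n = src t then if m = tgt t then ?G (src t) (tgt t) else 0 else 0)"
    by (intro sum.cong refl) (use z in auto)
  also have "\<dots> = (\<Sum>n\<le>length xs. if n = src t then \<Sum>m\<le>length ys. if m = tgt t then ?G (src t) (tgt t) else 0 else 0)"
    by (intro sum.cong refl) auto
  \<comment> \<open>If \<open>src t\<close> or \<open>tgt t\<close> exceeds the available length, no
    summand survives, and \<open>z\<close> makes the right-hand side 0 too.\<close>
  also have "\<dots> = ?G (src t) (tgt t)"
    using z[of "src t" "tgt t"] by auto
  finally show ?thesis by simp
qed

lemma ev_comb_Tens_split: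
  assumes "wt_comb c"
  shows "ev_comb d (map_comb (\<lambda>t. Tens t e) c) xs ys
    = (\<Sum>n\<le>length xs. \<Sum>m\<le>length ys. mtens n m (ev_comb d c) (ev d e) xs ys :: 'k::comm_ring_1)"
  using assms
proof (induction c)
  case (Cons p c)
  obtain r t where p: "p = (r, t)" by (cases p)
  with Cons have "wt t" "wt_comb c" by (auto simp: wt_comb_def)
  then show ?case using Cons.IH ev_Tens_split[of t d e xs ys, where 'k = 'k]
    by (simp add: p mtens_add_left mtens_scale_left sum.distrib sum_distrib_left del: ev.simps)
qed (simp add: mtens_def)

text \<open>Frees the differential from a fixed arity: for indices of the wrong lengths both sides
  vanish. This is what mixed combinations in \<open>Irel\<close> require.\<close>

lemma hdiff_arity:
  assumes "homp d d n m p F"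
  shows "hdiff d n m F xs ys = hdiff d (length xs) (length ys) F xs ys"
proof (cases "length xs = n \<and> length ys = m")
  case False
  have "hdiff d n m F xs ys = 0"
    using homp_zero[OF homp_hdiff[OF assms]] False by (auto dest: basis_length)
  moreover have "F xs us = 0" if "us \<in> basis d (length ys)" for us
    by (rule homp_zero[OF assms]) (use that False in \<open>auto dest!: basis_length\<close>)
  moreover have "F us ys = 0" if "us \<in> basis d (length xs)" for us
    by (rule homp_zero[OF assms]) (use that False in \<open>auto dest!: basis_length\<close>)
  ultimately show ?thesis by (simp add: hdiff_def)
qed simp

lemma ev_dcomb:
  fixes c :: "'k::comm_ring_1 comb"
  assumes "wt_comb c"
  shows "ev_comb d (dcomb c) xs ys = hdiff d (length xs) (length ys) (ev_comb d c) xs ys"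
  using assms
proof (induction c)
  case (Cons p c)
  obtain r t where p: "p = (r, t)" by (cases p)
  with Cons have w: "wt t" "wt_comb c" by (auto simp: wt_comb_def)
  show ?case
    using Cons.IH[OF w(2)] hdiff_arity[OF homp_ev[OF w(1)], where xs = xs and ys = ys and 'a = 'k, of d] ev_dS[OF w(1), of d, where 'k = 'k]
    by (simp add: p dcomb_def hdiff_add hdiff_scale)
qed (simp add: dcomb_def hdiff_zero)

text \<open>Collects equal expressions, so that formal cancellation of coefficients forces the
  evaluation to be 0.\<close>

lemma ev_comb_collect:
  assumes "finite S" "snd ` set c \<subseteq> S"
  shows "ev_comb d c xs ys
    = (\<Sum>t\<in>S. sum_list (map fst (filter (\<lambda>p. snd p = t) c)) * ev d t xs ys)"
  using assms(2)
proof (induction c)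
  case (Cons p c)
  obtain r t where p: "p = (r, t)" by (cases p)
  have "(\<Sum>u\<in>S. sum_list (map fst (filter (\<lambda>p. snd p = u) (p # c))) * ev d u xs ys)
     = (\<Sum>u\<in>S. (if u = t then r * ev d t xs ys else 0)
         + sum_list (map fst (filter (\<lambda>p. snd p = u) c)) * ev d u xs ys)"
    by (intro sum.cong refl) (auto simp: p distrib_right)
  also have "\<dots> = r * ev d t xs ys + ev_comb d c xs ys"
    using Cons assms(1) by (simp add: sum.distrib p)
  finally show ?case by (simp add: p)
qed simp

lemma wt_comb_simps [simp]:
  "wt_comb []" "wt_comb ((r, t) # c) \<longleftrightarrow> wt t \<and> wt_comb c"
  "wt_comb (c @ c') \<longleftrightarrow> wt_comb c \<and> wt_comb c'"
  by (auto simp: wt_comb_def)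

lemma wt_comb_smult [simp]: "wt_comb c \<Longrightarrow> wt_comb (smult_comb r c)"
  by (auto simp: wt_comb_def smult_comb_def)

lemma wt_comb_dcomb: "wt_comb (c :: 'k::comm_ring_1 comb) \<Longrightarrow> wt_comb (dcomb c)"
proof (induction c)
  case (Cons p c)
  obtain r t where p: "p = (r, t)" by (cases p)
  with Cons have w: "wt t" "wt_comb c" by auto
  have "wt_comb (dS t :: 'k comb)" using dS_typing[OF w(1)] by (auto simp: wt_comb_def)
  then show ?case using Cons w by (simp add: p dcomb_def)
qed (simp add: dcomb_def)

section \<open>Evaluation of the relations\<close>

lemma eqv_zero: "ev d a = (ev d b :: 'k::comm_ring_1 mat) \<Longrightarrow> ev_comb d (eqv a b) = (\<lambda>xs ys. 0 :: 'k)"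
  by (simp add: eqv_def)

text \<open>The composite has degree 1, but its target lies in degree 0.\<close>

lemma mcomp_eps_join: "mcomp d 1 (m_eps d) (m_join d) = (\<lambda>xs ys. 0 :: 'k::comm_ring_1)"
proof -
  note E = hom_el_mcomp[OF hom_el_m_join hom_el_m_eps, of d]
  have "mcomp d 1 (m_eps d) (m_join d) xs ys = (0 :: 'k)" for xs ys
  proof (rule ccontr)
    assume "mcomp d 1 (m_eps d) (m_join d) xs ys \<noteq> (0 :: 'k)"
    then have "ys \<in> basis d 0" "tdeg ys = tdeg xs + (0 + 1)"
      using E unfolding hom_el_def by blast+
    then show False by (simp add: basis_0)
  qed
  then show ?thesis by (simp add: fun_eq_iff)
qed

text \<open>The augmentation keeps only the cut whose first piece is a vertex, \<open>i = 0\<close>,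
  and there the second piece is all of \<open>s\<close>.\<close>

lemma counit_left:
  "mcomp d 2 (mtens 1 0 (m_eps d) (m_id d 1)) (m_aw d) = (m_id d 1 :: 'k::comm_ring_1 mat)"
proof (rule mat_eqI)
  note I = hom_el_homp[OF hom_el_m_id] and E = hom_el_homp[OF hom_el_m_eps]
    and A = hom_el_homp[OF hom_el_m_aw]
  have "homp d d 1 (0 + 1) (0 + (0 + 0)) (mcomp d (1 + 1) (mtens 1 0 (m_eps d) (m_id d 1)) (m_aw d) :: 'k mat)"
    by (intro homp_mcomp[OF _ homp_mtens[OF E I]]) (use A in \<open>simp add: numeral_2_eq_2\<close>)
  then show "homp d d 1 1 0 (mcomp d 2 (mtens 1 0 (m_eps d) (m_id d 1)) (m_aw d) :: 'k mat)"
    by (simp add: numeral_2_eq_2)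
  show "homp d d 1 1 0 (m_id d 1 :: 'k mat)" by (rule I)
  fix xs ys assume xs: "xs \<in> basis d 1" and ys: "ys \<in> basis d 1"
  obtain s where s: "xs = [s]" "s \<in> simplices d" using basis_1_cases[OF xs] .
  obtain z where z: "ys = [z]" "z \<in> simplices d" using basis_1_cases[OF ys] .
  have "mtens 1 0 (m_eps d) (m_id d 1) [take (Suc i) s, drop i s] [z] = (if i = 0 then m_id d 1 [s] [z] else 0 :: 'k)"
    if "i < length s" for i
    using that s z take_simplex[OF s(2), of i]
    by (auto simp: mtens_def m_eps_def m_id_def basis_single sdeg_def min_def)
  then have "mcomp d 2 (mtens 1 0 (m_eps d) (m_id d 1)) (m_aw d) [s] [z]
     = (\<Sum>i<length s. if i = 0 then m_id d 1 [s] [z] else 0 :: 'k)"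
    unfolding mcomp_m_aw[OF s(2)] by (intro sum.cong) auto
  then show "mcomp d 2 (mtens 1 0 (m_eps d) (m_id d 1)) (m_aw d) xs ys = (m_id d 1 xs ys :: 'k)"
    using simplex_nonempty[OF s(2)] by (simp add: s z)
qed

lemma counit_right:
  "mcomp d 2 (mtens 1 1 (m_id d 1) (m_eps d)) (m_aw d) = (m_id d 1 :: 'k::comm_ring_1 mat)"
proof (rule mat_eqI)
  note I = hom_el_homp[OF hom_el_m_id] and E = hom_el_homp[OF hom_el_m_eps]
    and A = hom_el_homp[OF hom_el_m_aw]
  have "homp d d 1 (1 + 0) (0 + (0 + 0)) (mcomp d (1 + 1) (mtens 1 1 (m_id d 1) (m_eps d)) (m_aw d) :: 'k mat)"
    by (intro homp_mcomp[OF _ homp_mtens[OF I E]]) (use A in \<open>simp add: numeral_2_eq_2\<close>)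
  then show "homp d d 1 1 0 (mcomp d 2 (mtens 1 1 (m_id d 1) (m_eps d)) (m_aw d) :: 'k mat)"
    by (simp add: numeral_2_eq_2)
  show "homp d d 1 1 0 (m_id d 1 :: 'k mat)" by (rule I)
  fix xs ys assume xs: "xs \<in> basis d 1" and ys: "ys \<in> basis d 1"
  obtain s where s: "xs = [s]" "s \<in> simplices d" using basis_1_cases[OF xs] .
  obtain z where z: "ys = [z]" "z \<in> simplices d" using basis_1_cases[OF ys] .
  have "mtens 1 1 (m_id d 1) (m_eps d) [take (Suc i) s, drop i s] [z]
      = (if i = length s - 1 then m_id d 1 [s] [z] else 0 :: 'k)"
    if "i < length s" for i
    using that s z drop_simplex[OF s(2) that]
    by (auto simp: mtens_def m_eps_def m_id_def basis_single sdeg_def)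
  then have "mcomp d 2 (mtens 1 1 (m_id d 1) (m_eps d)) (m_aw d) [s] [z]
     = (\<Sum>i<length s. if i = length s - 1 then m_id d 1 [s] [z] else 0 :: 'k)"
    unfolding mcomp_m_aw[OF s(2)] by (intro sum.cong) auto
  then show "mcomp d 2 (mtens 1 1 (m_id d 1) (m_eps d)) (m_aw d) xs ys = (m_id d 1 xs ys :: 'k)"
    using simplex_nonempty[OF s(2)] by (simp add: s z)
qed

lemma m_tau_involution: "mcomp d 2 (m_tau d) (m_tau d) = (m_id d 2 :: 'k::comm_ring_1 mat)"
proof (rule mat_eqI)
  have h: "homp d d 2 2 0 (m_tau d :: 'k mat)"
    using hom_el_homp[OF hom_el_swapm[of d 1 1]] by (simp add: m_tau_swapm numeral_2_eq_2)
  then show "homp d d 2 2 (0 + 0) (mcomp d 2 (m_tau d) (m_tau d) :: 'k mat)"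
    by (intro homp_mcomp)
  show "homp d d 2 2 0 (m_id d 2 :: 'k mat)" by (rule hom_el_homp[OF hom_el_m_id])
  fix xs ys assume xs: "xs \<in> basis d 2" and ys: "ys \<in> basis d 2"
  obtain s t where s: "xs = [s, t]" "s \<in> simplices d" "t \<in> simplices d" using basis_2_cases[OF xs] .
  have "mcomp d 2 (m_tau d) (m_tau d) xs ys = m_tau d xs [t, s] * (m_tau d [t, s] ys :: 'k)"
    by (rule mcomp_single) (use s in \<open>auto simp: m_tau_def basis_pair\<close>)
  also have "\<dots> = m_id d 2 xs ys"
    using s by (auto simp: m_tau_def m_id_def basis_pair mult.commute[of "sdeg t"] minus_one_power_iff)
  finally show "mcomp d 2 (m_tau d) (m_tau d) xs ys = (m_id d 2 xs ys :: 'k)" .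
qed

text \<open>Well-typedness is part of the induction because the cases \<open>tens_right\<close> and
  \<open>diff\<close> recover arities from typed terms.\<close>

lemma Irel_zero:
  "c \<in> (Irel :: 'k::comm_ring_1 comb set) \<Longrightarrow> wt_comb c \<and> ev_comb d c = (\<lambda>xs ys. 0)"
proof (induction rule: Irel.induct)
  case (formal_zero c)
  then show ?case
    using ev_comb_collect[of "snd ` set c" c d] by (simp add: fun_eq_iff)
next
  case (comp_left c e)
  then have "\<forall>(r, t)\<in>set c. tgt t = src e" by auto
  from ev_comb_Comp_left[OF this, of d e] comp_left show ?case
    by (auto simp: wt_comb_def map_comb_def mcomp_def fun_eq_iff)
next
  case (comp_right c e)
  then show ?case
    using ev_comb_Comp_right[of d e c] by (auto simp: wt_comb_def map_comb_def mcomp_def fun_eq_iff)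
next
  case (tens_left c e)
  then show ?case
    using ev_comb_Tens_left[of d e c] by (auto simp: wt_comb_def map_comb_def mtens_def fun_eq_iff)
next
  case (tens_right c e)
  then have "ev_comb d (map_comb (\<lambda>t. Tens t e) c) xs ys = 0" for xs ys
    by (subst ev_comb_Tens_split) (auto simp: mtens_def)
  then show ?case using tens_right by (auto simp: wt_comb_def map_comb_def fun_eq_iff)
next
  \<comment> \<open>By \<open>ev_dcomb\<close> the evaluation of \<open>dcomb c\<close> is the Hom
    differential of a matrix that is 0 by induction.\<close>
  case (diff c)
  then show ?case using ev_dcomb[of c d] wt_comb_dcomb[of c]
    by (auto simp: fun_eq_iff hdiff_def)
next
  case (comp_assoc a b c)
  then show ?case by (auto intro!: eqv_zero simp: mcomp_assoc) (simp add: eqv_def)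
next
  case (comp_idl a)
  then show ?case by (auto intro!: eqv_zero simp: ev_idn mcomp_id_left[OF homp_ev]) (simp add: eqv_def)
next
  case (comp_idr a)
  then show ?case by (auto intro!: eqv_zero simp: ev_idn mcomp_id_right[OF homp_ev]) (simp add: eqv_def)
next
  case id_idn
  show ?case by (auto intro!: eqv_zero simp: ev_idn simp del: idn.simps) (simp add: eqv_def)
next
  case (tens_assoc a b c)
  then show ?case by (auto intro!: eqv_zero simp: mtens_assoc) (simp add: eqv_def)
next
  case (tens_unitl a)
  then show ?case by (auto intro!: eqv_zero simp: mtens_id0_left[OF homp_ev]) (simp add: eqv_def)
next
  case (tens_unitr a)
  then show ?case by (auto intro!: eqv_zero simp: mtens_id0_right[OF homp_ev]) (simp add: eqv_def)
next
  case (interchange a b c e)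
  note I = interchange_law[OF homp_ev[OF interchange(1)] homp_ev[OF interchange(2)]
      homp_ev[OF interchange(3), folded interchange(5)] homp_ev[OF interchange(4), folded interchange(6)], where 'a = 'k, of d]
  show ?case using interchange I by simp
next
  case tau_inv
  show ?case
    using m_tau_involution[of d, where 'k = 'k]
    by (auto intro!: eqv_zero simp: ev_idn simp del: idn.simps) (simp add: eqv_def)
next
  case (tau_natural a b)
  note N = swapm_natural[OF homp_ev[OF tau_natural(1)] homp_ev[OF tau_natural(2)], where 'k = 'k, of d]
  show ?case using tau_natural N by (simp add: ev_bswap)
next
  case rel_eps_mu
  then show ?case using mcomp_eps_join[of d, where 'k = 'k] by simp
next
  case rel_counit_l
  then show ?case using counit_left[of d, where 'k = 'k] by (auto intro!: eqv_zero) (simp add: eqv_def)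
next
  case rel_counit_r
  then show ?case using counit_right[of d, where 'k = 'k] by (auto intro!: eqv_zero) (simp add: eqv_def)
qed auto

text \<open>For composites \<open>fpow\<close> is pushed through one factor after the other; for
  tensor products it splits by \<open>fpow_add\<close>, and both interchanges are free of
  signs.\<close>

lemma (in order_map) natural_ev:
  "wt x \<Longrightarrow> mcomp d (tgt x) (fpow d f (tgt x)) (ev d x)
    = (mcomp e (src x) (ev e x) (fpow d f (src x)) :: 'k::comm_ring_1 mat)"
proof (induction x)
  case (Gen g)
  show ?case
  proof (cases g)
    case Eps
    then show ?thesis using natural_eps[where 'k = 'k] by simp
  next
    case Dlt
    then show ?thesis using natural_aw[where 'k = 'k] by simp
  next
    case Mu
    then show ?thesis using natural_join[where 'k = 'k] by simp
  qed
next
  case Tau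
  then show ?case using natural_tau[where 'k = 'k] by simp
next
  case (Comp a b)
  then have w: "wt a" "wt b" "src a = tgt b" by auto
  have "mcomp d (tgt a) (fpow d f (tgt a)) (mcomp d (tgt b) (ev d a) (ev d b))
      = (mcomp d (tgt b) (mcomp e (tgt b) (ev e a) (fpow d f (tgt b))) (ev d b) :: 'k mat)"
    using Comp.IH(1) w by (simp add: mcomp_assoc[symmetric])
  also have "\<dots> = mcomp e (tgt b) (ev e a) (mcomp e (src b) (ev e b) (fpow d f (src b)))"
    using Comp.IH(2) w by (simp add: mcomp_assoc)
  finally show ?case by (simp add: mcomp_assoc)
next
  case (Tens a b)
  then have w: "wt a" "wt b" by auto
  show ?case
    using Tens.IH w
      interchange_law[OF homp_fpow homp_fpow homp_ev[OF w(1)] homp_ev[OF w(2)], where 'a = 'k]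
      interchange_law[OF homp_ev[OF w(1)] homp_ev[OF w(2)] homp_fpow homp_fpow, where 'a = 'k]
    by (simp add: fpow_add)
qed (simp_all add: mcomp_id_left[OF homp_fpow] mcomp_id_right[OF homp_fpow] del: One_nat_def)

text \<open>The recursion of \<open>ev\<close> already respects identities, the symmetry and both
  compositions, so descent to \<open>S\<close> amounts to vanishing on \<open>Irel\<close>.\<close>

theorem theorem4p2:
  fixes d :: nat
  shows "(\<forall>c \<in> (Irel :: 'k::comm_ring_1 comb set). ev_comb d c = (\<lambda>xs ys. 0))
    \<and> (\<forall>x. wt x \<longrightarrow> hom_el d (src x) (tgt x) (deg x) (ev d x :: 'k mat))
    \<and> (\<forall>x. wt x \<longrightarrow> ev_comb d (dS x) = hdiff d (src x) (tgt x) (ev d x :: 'k mat))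
    \<and> (\<forall>e f. mono_on {0..d} f \<and> f ` {0..d} \<subseteq> {0..e} \<longrightarrow>
         (\<forall>x. wt x \<longrightarrow>
            mcomp d (tgt x) (fpow d f (tgt x)) (ev d x)
              = (mcomp e (src x) (ev e x) (fpow d f (src x)) :: 'k mat)))"
proof (intro conjI ballI allI impI)
  show "ev_comb d c = (\<lambda>xs ys. 0)" if "c \<in> Irel" for c :: "'k comb"
    using Irel_zero[OF that] by blast
  show "hom_el d (src x) (tgt x) (deg x) (ev d x :: 'k mat)" if "wt x" for x
    using that by (rule hom_el_ev)
  show "ev_comb d (dS x) = hdiff d (src x) (tgt x) (ev d x :: 'k mat)" if "wt x" for x
    using that by (rule ev_dS)
  show "mcomp d (tgt x) (fpow d f (tgt x)) (ev d x)
      = (mcomp e (src x) (ev e x) (fpow d f (src x)) :: 'k mat)"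
    if f: "mono_on {0..d} f \<and> f ` {0..d} \<subseteq> {0..e}" and x: "wt x" for e f x
  proof -
    interpret order_map d e f using f by unfold_locales auto
    show ?thesis using x by (rule natural_ev)
  qed
qed

end
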